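(* Let $\alpha,\beta\ge -\frac12$, $\mu=\max(\alpha,\beta)$, and let $n>N\ge 2$ be integers satisfying $$0.63\, n > m_{\alpha,\beta}^2\,(N+1)^{2\mu+2}\log(N+1).$$ Let $f\in L^2_\omega(I)$, and consider observations $Y_i=f(X_i)+\varepsilon_i$, $1\le i\le n$, where $X_1,\dots,X_n$ are i.i.d. with the Beta $B(\alpha+1,\beta+1)$ distribution on $I=[-1,1]$ and the $\varepsilon_i$ are i.i.d. centered real random variables with variance $\sigma^2$. Let $\pmb\eta_n=\max_{1\le i\le n}|\varepsilon_i|$, let $\pi_N f$ be the orthogonal projection in $L^2_\omega(I)$ of $f$ onto $\mathrm{Span}\{\widetilde P_k^{(\alpha,\beta)}:0\le k\le N\}$, and let $\widehat f_{n,N}$ be the least squares estimator defined in the context. Then for any $0<\delta<1$, with probability at least $(1-\delta)^2$, $$\|f-\widehat f_{n,N}\|_\omega\le \|f-\pi_N f\|_\omega+\sqrt{2\kappa_2(A_N)}\;\frac{\Big(\frac1n\log\big(\frac2\delta\big)\Big)^{1/4}\|f-\pi_N f\|_\infty+\frac{\|f-\pi_N f\|_\omega}{\sqrt{\gamma_{\alpha,\beta}}}+\pmb\eta_n}{\frac{1}{\sqrt{\gamma_{\alpha,\beta}}}-\Big(\frac1n\log\big(\frac2\delta\big)\Big)^{1/4}\frac{\|\pi_N f\|_\infty}{\|\pi_N f\|_\omega}}.$$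
   Context: $I=[-1,1]$, $\omega_{\alpha,\beta}(x)=(1-x)^\alpha(1+x)^\beta$, $L^2_\omega(I)$ is the weighted space with $\|f\|_\omega^2=\int_I|f|^2\omega_{\alpha,\beta}\,dx$, and $\|\cdot\|_\infty$ is the sup norm on $I$. The Jacobi polynomials are $P_k^{(\alpha,\beta)}(x)=\frac{(-1)^k}{2^k k!}\frac{1}{\omega_{\alpha,\beta}(x)}\frac{d^k}{dx^k}\big(\omega_{\alpha,\beta}(x)(1-x^2)^k\big)$, and the normalized ones are $\widetilde P^{(\alpha,\beta)}_k=P^{(\alpha,\beta)}_k/\sqrt{h_k^{\alpha,\beta}}$ with $h_k^{\alpha,\beta}=\frac{2^{\alpha+\beta+1}\Gamma(k+\alpha+1)\Gamma(k+\beta+1)}{k!(2k+\alpha+\beta+1)\Gamma(k+\alpha+\beta+1)}$, so that $\|\widetilde P^{(\alpha,\beta)}_k\|_\omega=1$. The Beta $B(\alpha+1,\beta+1)$ distribution on $I$ has density $\omega_{\alpha,\beta}(x)/\gamma_{\alpha,\beta}$, with $\gamma_{\alpha,\beta}=2^{\alpha+\beta+1}B(\alpha+1,\beta+1)$, where $B(\cdot,\cdot)$ is the Beta function. Constants: $c_{\alpha,\beta}=\frac{\alpha+\beta+1}{2}$, $\ \eta_{\alpha,\beta}=\frac{\exp\big(\frac{2\max(\mu,0)}{12}+\frac{\max(\mu^2+\alpha\beta,0)}{8}\big)}{2^{(\alpha+\beta)/2}\Gamma(\mu+1)}$, $\ m_{\alpha,\beta}^2=\frac{1+\frac12\sqrt{c_{\alpha,\beta}/2}}{\mu+3/2}\,\eta_{\alpha,\beta}^2$.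 Random matrices: $B_N=\big[\frac{1}{\sqrt n}\widetilde P^{(\alpha,\beta)}_{k-1}(X_j)\big]_{1\le j\le n,\,1\le k\le N+1}$ and $A_N=B_N'B_N$ ($'$ denotes transpose). $\kappa_2(A_N)$ is the $2$-norm condition number, i.e. $\lambda_{\max}(A_N)/\lambda_{\min}(A_N)$ ($+\infty$ if $A_N$ is singular). Estimator: $\widehat f_{n,N}(x)=\sum_{k=1}^{N+1}\widehat c_k\,\widetilde P^{(\alpha,\beta)}_{k-1}(x)$, where $\widehat{\pmb C}=(\widehat c_1,\dots,\widehat c_{N+1})'$ is the least squares solution of $B_N\widehat{\pmb C}=\frac{1}{\sqrt n}(Y_1,\dots,Y_n)'$, that is $\widehat{\pmb C}=(B_N'B_N)^{-1}B_N'\,\frac{1}{\sqrt n}(Y_1,\dots,Y_n)'$ when $A_N$ is invertible.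
   Formalization: The formal theorem also assumes the denominator of the bound is positive (for tiny δ it can be negative and the inequality then fails); for k=0, (α+β+1)Γ(α+β+1) in h_0 is read as Γ(α+β+2), which covers α+β=-1. *)

theory Defs
  imports
    "HOL-Probability.Probability"
    "HOL-Computational_Algebra.Polynomial"
    "Jordan_Normal_Form.Spectral_Radius"
begin

section \<open>Jacobi weight and the associated measures on \<open>[-1,1]\<close>\<close>

text \<open>
  For a zero or negative exponent the value at the corresponding endpoint is the junk
  value \<open>0 powr a = 0\<close>; the endpoints are Lebesgue null, so this affects no integral.
\<close>
definition jacobi_weight :: "real \<Rightarrow> real \<Rightarrow> real \<Rightarrow> real" where
  "jacobi_weight \<alpha> \<beta> x = (1 - x) powr \<alpha> * (1 + x) powr \<beta>"

text \<open>The underlying space of this measure is the interval \<open>[-1,1]\<close>, not the real line.\<close>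
definition jacobi_measure :: "real \<Rightarrow> real \<Rightarrow> real measure" where
  "jacobi_measure \<alpha> \<beta> =
     density (restrict_space lborel {-1..1}) (\<lambda>x. ennreal (jacobi_weight \<alpha> \<beta> x))"

definition weighted_L2 :: "real \<Rightarrow> real \<Rightarrow> (real \<Rightarrow> real) set" where
  "weighted_L2 \<alpha> \<beta> = {f \<in> borel_measurable (jacobi_measure \<alpha> \<beta>).
     integrable (jacobi_measure \<alpha> \<beta>) (\<lambda>x. (f x)\<^sup>2)}"

definition weighted_inner :: "real \<Rightarrow> real \<Rightarrow> (real \<Rightarrow> real) \<Rightarrow> (real \<Rightarrow> real) \<Rightarrow> real" where
  "weighted_inner \<alpha> \<beta> f g = (LINT x|jacobi_measure \<alpha> \<beta>. f x * g x)"

definition weighted_norm :: "real \<Rightarrow> real \<Rightarrow> (real \<Rightarrow> real) \<Rightarrow> real" where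
  "weighted_norm \<alpha> \<beta> f = sqrt (LINT x|jacobi_measure \<alpha> \<beta>. \<bar>f x\<bar>\<^sup>2)"

text \<open>Extended-real valued: the functions involved need not be bounded.\<close>
definition sup_norm :: "(real \<Rightarrow> real) \<Rightarrow> ereal" where
  "sup_norm f = (SUP x\<in>{-1..1}. ereal \<bar>f x\<bar>)"

definition jacobi_gamma :: "real \<Rightarrow> real \<Rightarrow> real" where
  "jacobi_gamma \<alpha> \<beta> = 2 powr (\<alpha> + \<beta> + 1) * Beta (\<alpha> + 1) (\<beta> + 1)"


section \<open>Jacobi polynomials\<close>

definition rodrigues :: "real \<Rightarrow> real \<Rightarrow> nat \<Rightarrow> real \<Rightarrow> real" where
  "rodrigues \<alpha> \<beta> k x = (-1) ^ k / (2 ^ k * fact k) * (1 / jacobi_weight \<alpha> \<beta> x) *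
     (deriv ^^ k) (\<lambda>t. jacobi_weight \<alpha> \<beta> t * (1 - t\<^sup>2) ^ k) x"

text \<open>
  Rodrigues' formula makes sense in the open interval only (the weight may vanish or blow up
  at the endpoints); it determines a unique polynomial, which is then defined everywhere.
\<close>
definition jacobi_poly :: "real \<Rightarrow> real \<Rightarrow> nat \<Rightarrow> real poly" where
  "jacobi_poly \<alpha> \<beta> k = (THE p. \<forall>x\<in>{-1<..<1}. poly p x = rodrigues \<alpha> \<beta> k x)"

lemma iterated_deriv_weight:
  assumes "j \<le> k"
  shows "\<exists>q. \<forall>x\<in>{-1<..<1}. (deriv ^^ j) (\<lambda>t. jacobi_weight \<alpha> \<beta> t * (1 - t\<^sup>2) ^ k) x =
    (1 - x) powr (\<alpha> + real (k - j)) * (1 + x) powr (\<beta> + real (k - j)) * poly q x"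
  using assms
proof (induction j)
  case 0
  have "jacobi_weight \<alpha> \<beta> x * (1 - x\<^sup>2) ^ k =
      (1 - x) powr (\<alpha> + real k) * (1 + x) powr (\<beta> + real k) * poly 1 x"
    if "x \<in> {-1<..<1}" for x :: real
  proof -
    have "(1 - x\<^sup>2) ^ k = (1 - x) powr real k * (1 + x) powr real k"
      using that by (simp add: powr_realpow power_mult_distrib[symmetric])
        (simp add: algebra_simps power2_eq_square)
    then show ?thesis
      by (simp add: jacobi_weight_def powr_add)
  qed
  then show ?case
    by (intro exI[of _ 1]) simp
next
  case (Suc j)
  define a where "a = \<alpha> + real (k - j)"
  define b where "b = \<beta> + real (k - j)"
  define F where "F = (deriv ^^ j) (\<lambda>t. jacobi_weight \<alpha> \<beta> t * (1 - t\<^sup>2) ^ k)"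
  obtain q where q: "\<And>x. x \<in> {-1<..<1} \<Longrightarrow> F x = (1 - x) powr a * (1 + x) powr b * poly q x"
    using Suc by (auto simp: F_def a_def b_def)
  define s where "s = [:b - a, - a - b:] * q + [:1, 0, -1:] * pderiv q"
  have exps: "\<alpha> + real (k - Suc j) = a - 1" "\<beta> + real (k - Suc j) = b - 1"
    using Suc.prems by (auto simp: a_def b_def)
  have "deriv F x = (1 - x) powr (a - 1) * (1 + x) powr (b - 1) * poly s x"
    if x: "x \<in> {-1<..<1}" for x
  proof -
    have pos: "1 - x > 0" "1 + x > 0" using x by auto
    have p1: "(1 - x) powr a = (1 - x) powr (a - 1) * (1 - x)"
      and p2: "(1 + x) powr b = (1 + x) powr (b - 1) * (1 + x)"
      using pos by (simp_all add: powr_diff)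
    have d1: "((\<lambda>x. (1 - x) powr a) has_field_derivative - a * (1 - x) powr (a - 1)) (at x)"
      and d2: "((\<lambda>x. (1 + x) powr b) has_field_derivative b * (1 + x) powr (b - 1)) (at x)"
      using pos by (auto intro!: derivative_eq_intros simp: powr_diff)
    have "((\<lambda>x. (1 - x) powr a * (1 + x) powr b * poly q x) has_field_derivative
        (1 - x) powr (a - 1) * (1 + x) powr (b - 1) * poly s x) (at x)"
      by (rule DERIV_cong[OF DERIV_mult[OF DERIV_mult[OF d1 d2] poly_DERIV]])
        (simp add: s_def p1 p2 algebra_simps)
    then have "(F has_field_derivative
        (1 - x) powr (a - 1) * (1 + x) powr (b - 1) * poly s x) (at x)"
      by (rule has_field_derivative_transform_within_open[where S = "{-1<..<1}"])
        (use x q in auto)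
    then show ?thesis by (rule DERIV_imp_deriv)
  qed
  then show ?case
    unfolding exps by (intro exI[of _ s]) (simp add: F_def)
qed

lemma poly_jacobi_poly:
  assumes "x \<in> {-1<..<1}"
  shows "poly (jacobi_poly \<alpha> \<beta> k) x = rodrigues \<alpha> \<beta> k x"
proof -
  let ?P = "\<lambda>p. \<forall>x\<in>{-1<..<1}. poly p x = rodrigues \<alpha> \<beta> k x"
  obtain q where q: "\<And>x. x \<in> {-1<..<1} \<Longrightarrow>
      (deriv ^^ k) (\<lambda>t. jacobi_weight \<alpha> \<beta> t * (1 - t\<^sup>2) ^ k) x =
      (1 - x) powr \<alpha> * (1 + x) powr \<beta> * poly q x"
    using iterated_deriv_weight[of k k \<alpha> \<beta>] by auto
  have ex: "?P (Polynomial.smult ((-1) ^ k / (2 ^ k * fact k)) q)"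
    by (auto simp: rodrigues_def q) (simp add: jacobi_weight_def)
  have uniq: "p = p'" if "?P p" "?P p'" for p p'
  proof (rule ccontr)
    assume "p \<noteq> p'"
    then have "finite {x. poly (p - p') x = 0}" by (intro poly_roots_finite) simp
    moreover have "{-1<..<1} \<subseteq> {x. poly (p - p') x = 0}" using that by auto
    ultimately have "finite {-1<..<1::real}" using finite_subset by blast
    then show False using infinite_Ioo[of "-1::real" 1] by simp
  qed
  have "?P (jacobi_poly \<alpha> \<beta> k)"
    unfolding jacobi_poly_def by (rule theI[of ?P, OF ex]) (use uniq ex in blast)
  then show ?thesis using assms by blast
qed

text \<open>
  For \<open>k = 0\<close> the factor \<open>(\<alpha> + \<beta> + 1) * Gamma (\<alpha> + \<beta> + 1)\<close> of the usual formula is written as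
  \<open>Gamma (\<alpha> + \<beta> + 2)\<close>. This is the same number unless \<open>\<alpha> + \<beta> = -1\<close>, when the factor has
  the form \<open>0 * \<infinity>\<close> (and HOL's \<open>Gamma 0 = 0\<close> would give a wrong value); the Chebyshev case
  \<open>\<alpha> = \<beta> = -1/2\<close> is of this kind.
\<close>
definition jacobi_h :: "real \<Rightarrow> real \<Rightarrow> nat \<Rightarrow> real" where
  "jacobi_h \<alpha> \<beta> k =
     2 powr (\<alpha> + \<beta> + 1) * Gamma (real k + \<alpha> + 1) * Gamma (real k + \<beta> + 1) /
     (fact k * (if k = 0 then Gamma (\<alpha> + \<beta> + 2)
                else (2 * real k + \<alpha> + \<beta> + 1) * Gamma (real k + \<alpha> + \<beta> + 1)))"

definition normalized_jacobi :: "real \<Rightarrow> real \<Rightarrow> nat \<Rightarrow> real poly" where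
  "normalized_jacobi \<alpha> \<beta> k = Polynomial.smult (1 / sqrt (jacobi_h \<alpha> \<beta> k)) (jacobi_poly \<alpha> \<beta> k)"

definition jacobi_span :: "real \<Rightarrow> real \<Rightarrow> nat \<Rightarrow> real poly set" where
  "jacobi_span \<alpha> \<beta> N = {\<Sum>k\<le>N. Polynomial.smult (c k) (normalized_jacobi \<alpha> \<beta> k) |c. True}"

text \<open>The orthogonal projection onto the span, as a polynomial.\<close>
definition jacobi_proj :: "real \<Rightarrow> real \<Rightarrow> nat \<Rightarrow> (real \<Rightarrow> real) \<Rightarrow> real poly" where
  "jacobi_proj \<alpha> \<beta> N f = (THE p. p \<in> jacobi_span \<alpha> \<beta> N \<and>
     (\<forall>q\<in>jacobi_span \<alpha> \<beta> N. weighted_inner \<alpha> \<beta> (\<lambda>x. f x - poly p x) (poly q) = 0))"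


section \<open>Constants\<close>

definition jacobi_c :: "real \<Rightarrow> real \<Rightarrow> real" where
  "jacobi_c \<alpha> \<beta> = (\<alpha> + \<beta> + 1) / 2"

definition jacobi_eta :: "real \<Rightarrow> real \<Rightarrow> real" where
  "jacobi_eta \<alpha> \<beta> = (let \<mu> = max \<alpha> \<beta> in
     exp (2 * max \<mu> 0 / 12 + max (\<mu>\<^sup>2 + \<alpha> * \<beta>) 0 / 8) /
     (2 powr ((\<alpha> + \<beta>) / 2) * Gamma (\<mu> + 1)))"

definition jacobi_m_sq :: "real \<Rightarrow> real \<Rightarrow> real" where
  "jacobi_m_sq \<alpha> \<beta> = (let \<mu> = max \<alpha> \<beta> in
     (1 + 1 / 2 * sqrt (jacobi_c \<alpha> \<beta> / 2)) / (\<mu> + 3 / 2) * (jacobi_eta \<alpha> \<beta>)\<^sup>2)"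


section \<open>Random matrices and the least squares estimator\<close>

text \<open>Rows and columns are counted from \<open>0\<close>; column \<open>k\<close> belongs to the polynomial of degree \<open>k\<close>.\<close>
definition design_mat :: "real \<Rightarrow> real \<Rightarrow> nat \<Rightarrow> nat \<Rightarrow> (nat \<Rightarrow> real) \<Rightarrow> real mat" where
  "design_mat \<alpha> \<beta> n N x =
     Matrix.mat n (N + 1) (\<lambda>(j, k). 1 / sqrt (real n) * poly (normalized_jacobi \<alpha> \<beta> k) (x j))"

definition gram_mat :: "real \<Rightarrow> real \<Rightarrow> nat \<Rightarrow> nat \<Rightarrow> (nat \<Rightarrow> real) \<Rightarrow> real mat" where
  "gram_mat \<alpha> \<beta> n N x =
     transpose_mat (design_mat \<alpha> \<beta> n N x) * design_mat \<alpha> \<beta> n N x"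

text \<open>Intended for symmetric positive semidefinite matrices, such as \<open>gram_mat\<close>.\<close>
definition cond_number :: "real mat \<Rightarrow> ereal" where
  "cond_number A =
     (if invertible_mat A then ereal (Max (spectrum A) / Min (spectrum A)) else \<infinity>)"

definition is_least_squares :: "real mat \<Rightarrow> real Matrix.vec \<Rightarrow> real Matrix.vec \<Rightarrow> bool" where
  "is_least_squares B y c \<longleftrightarrow> c \<in> carrier_vec (dim_col B) \<and>
     (\<forall>d\<in>carrier_vec (dim_col B).
        scalar_prod (B *\<^sub>v c - y) (B *\<^sub>v c - y)
        \<le> scalar_prod (B *\<^sub>v d - y) (B *\<^sub>v d - y))"

text \<open>
  The choice matters only when the columns of the matrix are linearly dependent; otherwise the
  minimizer is unique.
\<close>
definition least_squares :: "real mat \<Rightarrow> real Matrix.vec \<Rightarrow> real Matrix.vec" where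
  "least_squares B y = (SOME c. is_least_squares B y c)"

definition jacobi_estimator ::
    "real \<Rightarrow> real \<Rightarrow> nat \<Rightarrow> nat \<Rightarrow> (nat \<Rightarrow> real) \<Rightarrow> (nat \<Rightarrow> real) \<Rightarrow> real poly" where
  "jacobi_estimator \<alpha> \<beta> n N x y =
     (let c = least_squares (design_mat \<alpha> \<beta> n N x)
                (Matrix.vec n (\<lambda>j. 1 / sqrt (real n) * y j))
      in \<Sum>k\<le>N. Polynomial.smult (vec_index c k) (normalized_jacobi \<alpha> \<beta> k))"

definition ereal_sqrt :: "ereal \<Rightarrow> ereal" where
  "ereal_sqrt x = (if x = \<infinity> then \<infinity> else ereal (sqrt (real_of_ereal x)))"

end

theory Submission
  imports Defs
begin

text \<open>
  Write \<open>c\<close> for the coefficients of \<open>\<pi>\<^sub>N f\<close>, \<open>d\<close> for those of the estimator, and \<open>A = B'B\<close>. Since the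
  normalized Jacobi polynomials are orthonormal, Pythagoras bounds the error by
  \<open>\<parallel>f - \<pi>\<^sub>N f\<parallel> + \<bar>c - d\<bar>\<close>. Least squares projects orthogonally, so
  \<open>\<lambda>\<^bsub>min\<^esub> \<bar>c - d\<bar>\<^sup>2 \<le> \<bar>B c - y\<bar>\<^sup>2\<close>. The upper left entry of \<open>A\<close> is \<open>1 / \<gamma>\<close>, hence \<open>\<lambda>\<^bsub>max\<^esub> \<ge> 1 / \<gamma>\<close> and
  \<open>\<bar>c - d\<bar> \<le> sqrt (\<kappa> \<gamma>) \<bar>B c - y\<bar>\<close>, while the denominator of the claimed bound is at most \<open>1 / sqrt \<gamma>\<close>.
  The residual \<open>B c - y\<close> splits into the noise and the sampled values of \<open>f - \<pi>\<^sub>N f\<close>; Hoeffding's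
  inequality controls the mean square of the latter by its expectation. Invertibility of \<open>A\<close> holds
  almost surely, because a polynomial of degree at most \<open>N\<close> is determined by more than \<open>N\<close> distinct
  sample points. It has to be part of the event: as \<open>\<infinity> * 0 = 0\<close>, an infinite condition number does
  not make the right-hand side infinite when the numerator vanishes.
\<close>

section \<open>Quadratic forms and least squares\<close>

definition quad_form :: "real mat \<Rightarrow> real Matrix.vec \<Rightarrow> real" where
  "quad_form A v = scalar_prod v (A *\<^sub>v v)"

lemma scalar_prod_self_nonneg: "scalar_prod v v \<ge> (0::real)"
  unfolding scalar_prod_def by (intro sum_nonneg) simp

lemma scalar_prod_self_eq_0:
  assumes "v \<in> carrier_vec n" "scalar_prod v v = (0::real)"
  shows "v = 0\<^sub>v n"
proof -
  have "(\<Sum>i\<in>{0..<n}. (vec_index v i)\<^sup>2) = 0"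
    using assms by (simp add: scalar_prod_def power2_eq_square)
  then have "\<forall>i\<in>{0..<n}. (vec_index v i)\<^sup>2 = 0"
    by (subst (asm) sum_nonneg_eq_0_iff) auto
  then show ?thesis using assms by (intro eq_vecI) auto
qed

lemma scalar_prod_self_pos:
  assumes "v \<in> carrier_vec n" "v \<noteq> 0\<^sub>v n"
  shows "scalar_prod v v > (0::real)"
  using scalar_prod_self_eq_0[OF assms(1)] scalar_prod_self_nonneg[of v] assms(2)
  by (metis order_le_less)

text \<open>Each product of two entries of \<open>v\<close> is at most
  \<open>scalar_prod v v\<close> in absolute value, so the sum of the absolute entries of
  \<open>A\<close> is a bound. The added 1 in \<open>K\<close> keeps it positive when that sum is
  zero.\<close>

lemma quad_form_bounded:
  assumes A: "A \<in> carrier_mat n n"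
  shows "\<exists>K>0. \<forall>v\<in>carrier_vec n. \<bar>quad_form A v\<bar> \<le> K * scalar_prod v v"
proof -
  define K where "K = 1 + (\<Sum>i<n. \<Sum>j<n. \<bar>A $$ (i, j)\<bar>)"
  have "\<bar>quad_form A v\<bar> \<le> K * scalar_prod v v" if v: "v \<in> carrier_vec n" for v
  proof -
    have le: "\<bar>vec_index v i\<bar> * \<bar>vec_index v j\<bar> \<le> scalar_prod v v" if "i < n" "j < n" for i j
    proof -
      have sq: "(vec_index v k)\<^sup>2 \<le> scalar_prod v v" if "k < n" for k
        using v that unfolding scalar_prod_def
        by (simp add: power2_eq_square) (rule member_le_sum, auto)
      have "2 * (\<bar>vec_index v i\<bar> * \<bar>vec_index v j\<bar>) \<le> (vec_index v i)\<^sup>2 + (vec_index v j)\<^sup>2"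
        using sum_squares_bound[of "\<bar>vec_index v i\<bar>" "\<bar>vec_index v j\<bar>"] by simp
      then show ?thesis using sq[OF that(1)] sq[OF that(2)] by linarith
    qed
    have "quad_form A v = (\<Sum>i<n. \<Sum>j<n. vec_index v i * (A $$ (i, j) * vec_index v j))"
      using A v by (simp add: quad_form_def scalar_prod_def sum_distrib_left lessThan_atLeast0)
    also have "\<bar>\<dots>\<bar> \<le> (\<Sum>i<n. \<Sum>j<n. \<bar>vec_index v i * (A $$ (i, j) * vec_index v j)\<bar>)"
      by (rule order_trans[OF sum_abs sum_mono]) (rule sum_abs)
    also have "\<dots> \<le> (\<Sum>i<n. \<Sum>j<n. \<bar>A $$ (i, j)\<bar> * scalar_prod v v)"
    proof (intro sum_mono)
      fix i j assume "i \<in> {..<n}" "j \<in> {..<n}"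
      then show "\<bar>vec_index v i * (A $$ (i, j) * vec_index v j)\<bar> \<le> \<bar>A $$ (i, j)\<bar> * scalar_prod v v"
        using mult_left_mono[OF le abs_ge_zero, of i j "A $$ (i, j)"] by (simp add: abs_mult mult_ac)
    qed
    also have "\<dots> \<le> K * scalar_prod v v"
      using scalar_prod_self_nonneg[of v] by (simp add: K_def distrib_right flip: sum_distrib_right)
    finally show ?thesis .
  qed
  moreover have "K > 0" unfolding K_def by (intro add_pos_nonneg sum_nonneg) auto
  ultimately show ?thesis by blast
qed

section \<open>Symmetric matrices: Cauchy-Schwarz inequality and extreme eigenvalues\<close>

lemma symmetric_scalar_prod:
  fixes A :: "real mat"
  assumes "A \<in> carrier_mat n n" "transpose_mat A = A" "v \<in> carrier_vec n" "w \<in> carrier_vec n"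
  shows "scalar_prod (A *\<^sub>v v) w = scalar_prod v (A *\<^sub>v w)"
  using transpose_vec_mult_scalar[of A n n w v] assms by simp

text \<open>The form at \<open>v + t w\<close> is a nonnegative quadratic polynomial in
  \<open>t\<close>, and its discriminant gives the claim. As \<open>A\<close> is only semidefinite,
  the form may vanish at \<open>w\<close>; the polynomial is then linear in \<open>t\<close> and
  must be constant.\<close>

lemma psd_cauchy_schwarz:
  fixes A :: "real mat"
  assumes A: "A \<in> carrier_mat n n" and sym: "transpose_mat A = A"
    and psd: "\<And>v. v \<in> carrier_vec n \<Longrightarrow> quad_form A v \<ge> 0"
    and v: "v \<in> carrier_vec n" and w: "w \<in> carrier_vec n"
  shows "(scalar_prod v (A *\<^sub>v w))\<^sup>2 \<le> quad_form A v * quad_form A w"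
proof -
  let ?b = "scalar_prod v (A *\<^sub>v w)"
  have Av: "A *\<^sub>v v \<in> carrier_vec n" and Aw: "A *\<^sub>v w \<in> carrier_vec n" using A v w by auto
  have b': "scalar_prod w (A *\<^sub>v v) = ?b"
    using symmetric_scalar_prod[OF A sym v w] comm_scalar_prod[OF w Av] by simp
  have q: "quad_form A v + 2 * t * ?b + t\<^sup>2 * quad_form A w \<ge> 0" for t
  proof -
    have "quad_form A (v + t \<cdot>\<^sub>v w) = quad_form A v + 2 * t * ?b + t\<^sup>2 * quad_form A w"
      using A v w Av Aw b'
      by (simp add: quad_form_def mult_add_distrib_mat_vec mult_mat_vec add_scalar_prod_distrib[of _ n]
          scalar_prod_add_distrib[of _ n] smult_scalar_prod_distrib[of _ n]
          scalar_prod_smult_distrib[of _ n] algebra_simps power2_eq_square)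
    then show ?thesis using psd[of "v + t \<cdot>\<^sub>v w"] v w by simp
  qed
  show ?thesis
  proof (cases "quad_form A w = 0")
    case True
    have "?b = 0"
    proof (rule ccontr)
      assume "?b \<noteq> 0"
      \<comment> \<open>At this \<open>t\<close> the linear polynomial takes the value -1.\<close>
      then show False using q[of "- (quad_form A v + 1) / (2 * ?b)"] True by (simp add: field_simps)
    qed
    then show ?thesis using True by simp
  next
    case False
    then have pos: "quad_form A w > 0" using psd[OF w] by simp
    \<comment> \<open>Evaluation at the minimizer of the quadratic polynomial.\<close>
    have "quad_form A v - ?b\<^sup>2 / quad_form A w \<ge> 0"
      using q[of "- ?b / quad_form A w"] pos by (simp add: field_simps power2_eq_square)
    then show ?thesis using pos by (simp add: field_simps)
  qed
qed

text \<open>Cauchy-Schwarz for \<open>v\<close> and \<open>w = B v\<close>, where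
  \<open>A w = v\<close>, bounds the square of \<open>scalar_prod v v\<close> by
  \<open>quad_form A v * quad_form B v\<close>. An upper bound \<open>K\<close> for the form of the
  inverse thus yields the lower bound \<open>1 / K\<close> for the form of \<open>A\<close>.\<close>

lemma psd_invertible_coercive:
  fixes A :: "real mat"
  assumes A: "A \<in> carrier_mat n n" and sym: "transpose_mat A = A"
    and psd: "\<And>v. v \<in> carrier_vec n \<Longrightarrow> quad_form A v \<ge> 0"
    and B: "B \<in> carrier_mat n n" "A * B = 1\<^sub>m n"
  shows "\<exists>c>0. \<forall>v\<in>carrier_vec n. c * scalar_prod v v \<le> quad_form A v"
proof -
  obtain K where K: "K > 0" "\<And>v. v \<in> carrier_vec n \<Longrightarrow> \<bar>quad_form B v\<bar> \<le> K * scalar_prod v v"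
    using quad_form_bounded[OF B(1)] by blast
  have "1 / K * scalar_prod v v \<le> quad_form A v" if v: "v \<in> carrier_vec n" for v
  proof (cases "scalar_prod v v = 0")
    case True
    then show ?thesis using psd[OF v] by simp
  next
    case False
    then have pos: "scalar_prod v v > 0" using scalar_prod_self_nonneg[of v] by linarith
    have w: "B *\<^sub>v v \<in> carrier_vec n" using B v by auto
    have ABv: "A *\<^sub>v (B *\<^sub>v v) = v"
      using A B v by (simp flip: assoc_mult_mat_vec)
    have "quad_form A (B *\<^sub>v v) = quad_form B v"
      unfolding quad_form_def ABv using comm_scalar_prod[OF w v] by simp
    then have "(scalar_prod v v)\<^sup>2 \<le> quad_form A v * quad_form B v"
      using psd_cauchy_schwarz[OF A sym psd v w] ABv by simp
    also have "\<dots> \<le> quad_form A v * (K * scalar_prod v v)"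
      using K(2)[OF v] psd[OF v] by (intro mult_left_mono) auto
    finally show ?thesis using pos K(1) by (simp add: field_simps power2_eq_square)
  qed
  then show ?thesis using K(1) by (intro exI[of _ "1 / K"]) auto
qed

text \<open>The candidate is the supremum \<open>m\<close> of all lower bounds of the Rayleigh
  quotient. If \<open>m\<close> were not an eigenvalue, \<open>A - m I\<close> would be semidefinite
  and invertible, hence coercive with some \<open>c > 0\<close>, and \<open>m + c\<close> would be a
  larger lower bound.\<close>

lemma symmetric_min_eigenvalue:
  fixes A :: "real mat"
  assumes A: "A \<in> carrier_mat n n" and sym: "transpose_mat A = A" and n: "n > 0"
  shows "\<exists>m. eigenvalue A m \<and> (\<forall>v\<in>carrier_vec n. m * scalar_prod v v \<le> quad_form A v)"
proof -
  define S where "S = {m. \<forall>v\<in>carrier_vec n. m * scalar_prod v v \<le> quad_form A v}"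
  define m where "m = Sup S"
  obtain K where K: "\<And>v. v \<in> carrier_vec n \<Longrightarrow> \<bar>quad_form A v\<bar> \<le> K * scalar_prod v v"
    using quad_form_bounded[OF A] by blast
  have ne: "- K \<in> S" using K by (force simp: S_def)
  \<comment> \<open>The form at one unit vector bounds \<open>S\<close> from above; such a vector
    exists because \<open>n > 0\<close>.\<close>
  let ?e = "unit_vec n 0 :: real Matrix.vec"
  have e: "?e \<in> carrier_vec n" "scalar_prod ?e ?e = 1" using n by auto
  have bdd: "bdd_above S"
  proof (rule bdd_aboveI)
    fix x assume "x \<in> S"
    then have "x * scalar_prod ?e ?e \<le> quad_form A ?e" using e(1) unfolding S_def by blast
    then show "x \<le> quad_form A ?e" using e(2) by simp
  qed
  have mS: "m * scalar_prod v v \<le> quad_form A v" if v: "v \<in> carrier_vec n" for v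
  proof (cases "scalar_prod v v = 0")
    case True
    then have "v = 0\<^sub>v n" using scalar_prod_self_eq_0[OF v] by simp
    then show ?thesis using A by (simp add: quad_form_def)
  next
    case False
    then have pos: "scalar_prod v v > 0" using scalar_prod_self_nonneg[of v] by linarith
    have "m \<le> quad_form A v / scalar_prod v v"
      unfolding m_def
    proof (rule cSup_least)
      show "S \<noteq> {}" using ne by auto
    qed (use pos v in \<open>simp add: S_def field_simps\<close>)
    then show ?thesis using pos by (simp add: field_simps)
  qed
  have "eigenvalue A m"
  proof (rule ccontr)
    assume *: "\<not> eigenvalue A m"
    define B where "B = A + (- m) \<cdot>\<^sub>m 1\<^sub>m n"
    have Bc: "B \<in> carrier_mat n n" using A by (simp add: B_def)
    have symB: "transpose_mat B = B"
    proof (rule eq_matI)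
      fix i j assume "i < dim_row B" "j < dim_col B"
      then have ij: "i < n" "j < n" using Bc by auto
      then have "A $$ (j, i) = A $$ (i, j)" using sym A index_transpose_mat(1)[of i A j] by simp
      then show "transpose_mat B $$ (i, j) = B $$ (i, j)" using ij A Bc by (auto simp: B_def)
    qed (use Bc in auto)
    have Bv: "B *\<^sub>v v = A *\<^sub>v v - m \<cdot>\<^sub>v v" if "v \<in> carrier_vec n" for v
      using A that by (simp add: B_def add_mult_distrib_mat_vec[of _ n n] minus_add_uminus_vec[of _ n])
        (rule eq_vecI, auto)
    have qB: "quad_form B v = quad_form A v - m * scalar_prod v v" if "v \<in> carrier_vec n" for v
      using A that by (simp add: quad_form_def Bv scalar_prod_minus_distrib[of _ n])
    have "det B \<noteq> 0"
    proof
      assume "det B = 0"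
      then obtain v where v: "v \<in> carrier_vec n" "v \<noteq> 0\<^sub>v n" "B *\<^sub>v v = 0\<^sub>v n"
        using det_0_iff_vec_prod_zero[OF Bc] by blast
      then have "A *\<^sub>v v = m \<cdot>\<^sub>v v"
        using Bv[OF v(1)] A by (intro eq_vecI) (auto dest!: arg_cong[of _ _ "\<lambda>u. vec_index u _"] simp: vec_eq_iff)
      then show False using * v A by (auto simp: eigenvalue_def eigenvector_def)
    qed
    then obtain C where C: "C \<in> carrier_mat n n" "B * C = 1\<^sub>m n"
      using det_non_zero_imp_unit[OF Bc] by (auto simp: Units_def ring_mat_def)
    obtain c where c: "c > 0" "\<And>v. v \<in> carrier_vec n \<Longrightarrow> c * scalar_prod v v \<le> quad_form B v"
      using psd_invertible_coercive[OF Bc symB _ C] mS qB by fastforce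
    have "m + c \<in> S" using c(2) qB by (fastforce simp: S_def algebra_simps)
    then have "m + c \<le> m" unfolding m_def using bdd by (rule cSup_upper)
    then show False using c(1) by simp
  qed
  then show ?thesis using mS by blast
qed

text \<open>Some eigenvalue is a lower bound of the Rayleigh quotient, and the least one is no
  larger. For \<open>n = 0\<close> the minimum is taken over an empty set, but both sides are
  0.\<close>

lemma Min_spectrum_le_quad_form:
  fixes A :: "real mat"
  assumes A: "A \<in> carrier_mat n n" and sym: "transpose_mat A = A" and v: "v \<in> carrier_vec n"
  shows "Min (spectrum A) * scalar_prod v v \<le> quad_form A v"
proof (cases "n = 0")
  case True
  then show ?thesis using A v by (simp add: quad_form_def scalar_prod_def)
next
  case False
  then obtain m where m: "eigenvalue A m" "m * scalar_prod v v \<le> quad_form A v"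
    using symmetric_min_eigenvalue[OF A sym] v by blast
  have "Min (spectrum A) \<le> m"
    using m(1) card_finite_spectrum(1)[OF A] by (intro Min_le) (auto simp: spectrum_def)
  then show ?thesis
    using m(2) mult_right_mono[OF _ scalar_prod_self_nonneg[of v]] order_trans by blast
qed

text \<open>The lower bound for \<open>- A\<close> is used: if \<open>m\<close> is an eigenvalue of
  \<open>- A\<close>, then \<open>- m\<close> is one of \<open>A\<close>.\<close>

lemma quad_form_le_Max_spectrum:
  fixes A :: "real mat"
  assumes A: "A \<in> carrier_mat n n" and sym: "transpose_mat A = A" and v: "v \<in> carrier_vec n"
  shows "quad_form A v \<le> Max (spectrum A) * scalar_prod v v"
proof (cases "n = 0")
  case True
  then show ?thesis using A v by (simp add: quad_form_def scalar_prod_def)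
next
  case False
  have "transpose_mat (- A) = - A" using sym A by (metis transpose_uminus)
  then obtain m where m: "eigenvalue (- A) m" "m * scalar_prod v v \<le> quad_form (- A) v"
    using symmetric_min_eigenvalue[of "- A" n] A False v by auto
  have uA: "(- A) *\<^sub>v w = - (A *\<^sub>v w)" if "w \<in> carrier_vec n" for w
    using A that by simp
  have "eigenvalue A (- m)"
  proof -
    obtain w where w: "w \<in> carrier_vec n" "w \<noteq> 0\<^sub>v n" "(- A) *\<^sub>v w = m \<cdot>\<^sub>v w"
      using m(1) A by (auto simp: eigenvalue_def eigenvector_def)
    have "A *\<^sub>v w = (- m) \<cdot>\<^sub>v w"
      using w(3) uA[OF w(1)] A w(1) by (auto simp: vec_eq_iff)
    then show ?thesis using w A by (auto simp: eigenvalue_def eigenvector_def)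
  qed
  then have "- m \<le> Max (spectrum A)"
    using card_finite_spectrum(1)[OF A] by (intro Max_ge) (auto simp: spectrum_def)
  moreover have "quad_form (- A) v = - quad_form A v"
    using A v by (simp add: quad_form_def uA)
  ultimately show ?thesis
    using m(2) mult_right_mono[OF _ scalar_prod_self_nonneg[of v], of "- m" "Max (spectrum A)"] by simp
qed

section \<open>Gram matrices and least squares\<close>

lemma quad_form_gram:
  fixes B :: "real mat"
  assumes B: "B \<in> carrier_mat n m" and v: "v \<in> carrier_vec m"
  shows "quad_form (transpose_mat B * B) v = scalar_prod (B *\<^sub>v v) (B *\<^sub>v v)"
proof -
  have Bv: "B *\<^sub>v v \<in> carrier_vec n" using B v by simp
  have "(transpose_mat B * B) *\<^sub>v v = transpose_mat B *\<^sub>v (B *\<^sub>v v)"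
    using B v by (simp add: assoc_mult_mat_vec[of _ m n])
  then show ?thesis
    unfolding quad_form_def using transpose_vec_mult_scalar[OF B v Bv] comm_scalar_prod[OF v, of "transpose_mat B *\<^sub>v (B *\<^sub>v v)"] B Bv
    by simp
qed

lemma symmetric_gram:
  fixes B :: "real mat"
  assumes "B \<in> carrier_mat n m"
  shows "transpose_mat (transpose_mat B * B) = transpose_mat B * B"
  using assms by (simp add: transpose_mult[of _ m n])

text \<open>A vector \<open>v\<close> in the kernel of the Gram matrix has \<open>B v\<close> of
  length 0, so injectivity of \<open>B\<close> makes the kernel trivial.\<close>

lemma gram_invertible:
  fixes B :: "real mat"
  assumes B: "B \<in> carrier_mat n m"
    and inj: "\<And>v. v \<in> carrier_vec m \<Longrightarrow> B *\<^sub>v v = 0\<^sub>v n \<Longrightarrow> v = 0\<^sub>v m"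
  obtains C where "C \<in> carrier_mat m m" "transpose_mat B * B * C = 1\<^sub>m m"
    "C * (transpose_mat B * B) = 1\<^sub>m m"
proof -
  let ?A = "transpose_mat B * B"
  have A: "?A \<in> carrier_mat m m" using B by auto
  have "det ?A \<noteq> 0"
  proof
    assume "det ?A = 0"
    then obtain v where v: "v \<in> carrier_vec m" "v \<noteq> 0\<^sub>v m" "?A *\<^sub>v v = 0\<^sub>v m"
      using det_0_iff_vec_prod_zero[OF A] by blast
    have "scalar_prod (B *\<^sub>v v) (B *\<^sub>v v) = 0"
      using quad_form_gram[OF B v(1)] v by (simp add: quad_form_def)
    then have "B *\<^sub>v v = 0\<^sub>v n"
      using B v(1) by (intro scalar_prod_self_eq_0) auto
    then show False using inj v by blast
  qed
  then have "?A \<in> Units (ring_mat TYPE(real) m ())"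
    by (rule det_non_zero_imp_unit[OF A])
  then show ?thesis using that by (auto simp: Units_def ring_mat_def)
qed

text \<open>The solution \<open>c0\<close> of the normal equations has a residual orthogonal to the
  range of \<open>B\<close>, so Pythagoras splits the objective. Injectivity makes \<open>c0\<close>
  the only minimizer, so it is the vector that \<open>least_squares\<close> chooses. The inequality
  says that the orthogonal projection onto the range of \<open>B\<close> does not increase
  lengths.\<close>

lemma least_squares_eq:
  fixes B :: "real mat"
  assumes B: "B \<in> carrier_mat n m" and y: "y \<in> carrier_vec n"
    and inj: "\<And>v. v \<in> carrier_vec m \<Longrightarrow> B *\<^sub>v v = 0\<^sub>v n \<Longrightarrow> v = 0\<^sub>v m"
  shows "least_squares B y \<in> carrier_vec m"
    and "c \<in> carrier_vec m \<Longrightarrow>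
      scalar_prod (B *\<^sub>v (c - least_squares B y)) (B *\<^sub>v (c - least_squares B y)) \<le>
      scalar_prod (B *\<^sub>v c - y) (B *\<^sub>v c - y)"
proof -
  let ?Bt = "transpose_mat B"
  obtain C where C: "C \<in> carrier_mat m m" "?Bt * B * C = 1\<^sub>m m"
    using gram_invertible[OF B inj] by metis
  define c0 where "c0 = C *\<^sub>v (?Bt *\<^sub>v y)"
  have c0: "c0 \<in> carrier_vec m" using B C y by (simp add: c0_def)
  define r where "r = B *\<^sub>v c0 - y"
  have r: "r \<in> carrier_vec n" using B c0 y by (simp add: r_def)
  have "?Bt *\<^sub>v (B *\<^sub>v c0) = (?Bt * B) *\<^sub>v c0"
    using B c0 by (simp add: assoc_mult_mat_vec[of _ m n])
  also have "\<dots> = (?Bt * B * C) *\<^sub>v (?Bt *\<^sub>v y)"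
    unfolding c0_def using B C y by (subst assoc_mult_mat_vec[of _ m m _ m]) auto
  also have "\<dots> = ?Bt *\<^sub>v y" using C B y by simp
  finally have "?Bt *\<^sub>v r = 0\<^sub>v m"
    unfolding r_def using B c0 y by (simp add: mult_minus_distrib_mat_vec[of _ m n])
  \<comment> \<open>The normal equations say exactly that the residual is orthogonal to the range of
    \<open>B\<close>.\<close>
  then have orth: "scalar_prod (B *\<^sub>v v) r = 0" if "v \<in> carrier_vec m" for v
    using transpose_vec_mult_scalar[OF B that r] comm_scalar_prod[of r n "B *\<^sub>v v"] r B that by simp
  have pyth: "scalar_prod (B *\<^sub>v d - y) (B *\<^sub>v d - y) =
      scalar_prod (B *\<^sub>v (d - c0)) (B *\<^sub>v (d - c0)) + scalar_prod r r"
    if d: "d \<in> carrier_vec m" for d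
  proof -
    have w: "B *\<^sub>v (d - c0) \<in> carrier_vec n" using B d c0 by simp
    have "B *\<^sub>v d - y = B *\<^sub>v (d - c0) + r"
      unfolding r_def mult_minus_distrib_mat_vec[OF B d c0] using B d c0 y by (intro eq_vecI) auto
    then show ?thesis
      using orth[of "d - c0"] d c0 comm_scalar_prod[OF w r] w r
      by (simp add: add_scalar_prod_distrib[of _ n] scalar_prod_add_distrib[of _ n])
  qed
  have self0: "B *\<^sub>v (c0 - c0) = 0\<^sub>v n" using B c0 by auto
  have "is_least_squares B y c0"
    using c0 B pyth pyth[OF c0] self0 scalar_prod_self_nonneg by (auto simp: is_least_squares_def)
  then have "is_least_squares B y (least_squares B y)"
    unfolding least_squares_def by (rule someI)
  then have l: "least_squares B y \<in> carrier_vec m"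
    and "scalar_prod (B *\<^sub>v least_squares B y - y) (B *\<^sub>v least_squares B y - y) \<le> scalar_prod r r"
    using B c0 by (auto simp: is_least_squares_def r_def)
  \<comment> \<open>The objective at the chosen vector exceeds that at \<open>c0\<close> by this
    squared length, and it cannot exceed the minimum.\<close>
  then have "scalar_prod (B *\<^sub>v (least_squares B y - c0)) (B *\<^sub>v (least_squares B y - c0)) = 0"
    using pyth[OF l] scalar_prod_self_nonneg[of "B *\<^sub>v (least_squares B y - c0)"] by linarith
  then have "B *\<^sub>v (least_squares B y - c0) = 0\<^sub>v n"
    using B l c0 by (intro scalar_prod_self_eq_0) auto
  then have "least_squares B y - c0 = 0\<^sub>v m" using inj l c0 by simp
  then have eq: "least_squares B y = c0"
    using l c0 by (auto simp: vec_eq_iff)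
  show "least_squares B y \<in> carrier_vec m" by (rule l)
  show "scalar_prod (B *\<^sub>v (c - least_squares B y)) (B *\<^sub>v (c - least_squares B y)) \<le>
      scalar_prod (B *\<^sub>v c - y) (B *\<^sub>v c - y)" if "c \<in> carrier_vec m"
    unfolding eq pyth[OF that] using scalar_prod_self_nonneg[of r] by simp
qed

text \<open>The test vector \<open>e\<close> shows that \<open>g\<close> is at most the largest
  eigenvalue. This converts the stability constant, the reciprocal of the smallest eigenvalue, into
  \<open>\<kappa> / g\<close>, where only the condition number remains.\<close>

lemma least_squares_error:
  fixes B :: "real mat"
  assumes B: "B \<in> carrier_mat n m" and y: "y \<in> carrier_vec n" and c: "c \<in> carrier_vec m"
    and inj: "\<And>v. v \<in> carrier_vec m \<Longrightarrow> B *\<^sub>v v = 0\<^sub>v n \<Longrightarrow> v = 0\<^sub>v m"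
    and e: "e \<in> carrier_vec m" "scalar_prod e e = 1"
      "scalar_prod (B *\<^sub>v e) (B *\<^sub>v e) = g" "g > 0"
  obtains \<kappa> where "\<kappa> > 0" "cond_number (transpose_mat B * B) = ereal \<kappa>"
    "g * scalar_prod (c - least_squares B y) (c - least_squares B y) \<le>
      \<kappa> * scalar_prod (B *\<^sub>v c - y) (B *\<^sub>v c - y)"
proof -
  let ?A = "transpose_mat B * B"
  have A: "?A \<in> carrier_mat m m" using B by auto
  note sym = symmetric_gram[OF B]
  have m: "m > 0" using e(1,2) by (cases m) (auto simp: scalar_prod_def)
  have fin: "finite (spectrum ?A)" by (rule card_finite_spectrum(1)[OF A])
  obtain l where "eigenvalue ?A l" using symmetric_min_eigenvalue[OF A sym m] by blast
  then have ne: "spectrum ?A \<noteq> {}" by (auto simp: spectrum_def)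
  \<comment> \<open>The smallest eigenvalue is positive because \<open>B\<close> does not annihilate
    its eigenvector.\<close>
  have "Min (spectrum ?A) \<in> spectrum ?A" using fin ne by (rule Min_in)
  then obtain v where v: "v \<in> carrier_vec m" "v \<noteq> 0\<^sub>v m" "?A *\<^sub>v v = Min (spectrum ?A) \<cdot>\<^sub>v v"
    using A by (auto simp: spectrum_def eigenvalue_def eigenvector_def)
  have "Min (spectrum ?A) * scalar_prod v v = scalar_prod (B *\<^sub>v v) (B *\<^sub>v v)"
    using quad_form_gram[OF B v(1)] v by (simp add: quad_form_def)
  moreover have "B *\<^sub>v v \<noteq> 0\<^sub>v n" using inj v by blast
  then have "scalar_prod (B *\<^sub>v v) (B *\<^sub>v v) > 0"
    using B v(1) by (intro scalar_prod_self_pos) auto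
  ultimately have min: "Min (spectrum ?A) > 0"
    using scalar_prod_self_nonneg[of v] by (metis zero_less_mult_pos2 scalar_prod_self_pos[OF v(1,2)])
  have max: "g \<le> Max (spectrum ?A)"
    using quad_form_le_Max_spectrum[OF A sym e(1)] quad_form_gram[OF B e(1)] e by simp
  have "invertible_mat ?A"
    using gram_invertible[OF B inj] A unfolding invertible_mat_def inverts_mat_def square_mat.simps
    by (metis carrier_matD)
  then have k: "cond_number ?A = ereal (Max (spectrum ?A) / Min (spectrum ?A))"
    by (simp add: cond_number_def)
  note l = least_squares_eq(1)[OF B y inj]
  let ?d = "c - least_squares B y"
  have d: "?d \<in> carrier_vec m" using c l by simp
  have "g * scalar_prod ?d ?d \<le> Max (spectrum ?A) * scalar_prod ?d ?d"
    using max scalar_prod_self_nonneg by (rule mult_right_mono)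
  also have "\<dots> = Max (spectrum ?A) / Min (spectrum ?A) * (Min (spectrum ?A) * scalar_prod ?d ?d)"
    using min by simp
  also have "\<dots> \<le> Max (spectrum ?A) / Min (spectrum ?A) * scalar_prod (B *\<^sub>v c - y) (B *\<^sub>v c - y)"
  proof (rule mult_left_mono)
    have "Min (spectrum ?A) * scalar_prod ?d ?d \<le> scalar_prod (B *\<^sub>v ?d) (B *\<^sub>v ?d)"
      using Min_spectrum_le_quad_form[OF A sym d] quad_form_gram[OF B d] by simp
    also have "\<dots> \<le> scalar_prod (B *\<^sub>v c - y) (B *\<^sub>v c - y)"
      by (rule least_squares_eq(2)[OF B y inj c])
    finally show "Min (spectrum ?A) * scalar_prod ?d ?d \<le> scalar_prod (B *\<^sub>v c - y) (B *\<^sub>v c - y)" .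
  qed (use min max e(4) in simp)
  finally show ?thesis using that[OF _ k] min max e(4) by simp
qed


section \<open>Orthonormality of the Jacobi polynomials\<close>

lemma jacobi_weight_nonneg: "jacobi_weight a b x \<ge> 0"
  by (simp add: jacobi_weight_def)

lemma measurable_jacobi_weight [measurable]: "jacobi_weight a b \<in> borel_measurable borel"
  unfolding jacobi_weight_def by measurable

lemma measurable_jacobi_measure_eq:
  "measurable (jacobi_measure a b) M = measurable (restrict_space borel {-1..1}) M"
  by (intro measurable_cong_sets) (simp_all add: jacobi_measure_def sets_restrict_space)

lemma space_jacobi_measure [simp]: "space (jacobi_measure a b) = {-1..1}"
  by (simp add: jacobi_measure_def space_restrict_space)

lemma borel_measurable_jacobi_measure:
  "f \<in> borel_measurable borel \<Longrightarrow> f \<in> borel_measurable (jacobi_measure a b)"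
  unfolding measurable_jacobi_measure_eq by (rule measurable_restrict_space1)

lemma measurable_poly_jacobi [measurable]: "poly p \<in> borel_measurable (jacobi_measure a b)"
  by (intro borel_measurable_jacobi_measure borel_measurable_continuous_onI continuous_intros)

lemma weight_measurable_restrict:
  "jacobi_weight a b \<in> borel_measurable (restrict_space lborel {-1..1})"
  using measurable_jacobi_weight[of a b] by (intro measurable_restrict_space1) simp

lemma integrable_jacobi_measure_iff:
  assumes "f \<in> borel_measurable (jacobi_measure a b)"
  shows "integrable (jacobi_measure a b) f \<longleftrightarrow>
    set_integrable lborel {-1..1} (\<lambda>x. jacobi_weight a b x * f x)"
  using assms weight_measurable_restrict[of a b]
  by (simp add: jacobi_measure_def integrable_density jacobi_weight_nonneg integrable_restrict_space
      set_integrable_def)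

lemma integral_jacobi_measure:
  assumes "f \<in> borel_measurable (jacobi_measure a b)"
  shows "integral\<^sup>L (jacobi_measure a b) f = (LINT x:{-1..1}|lborel. jacobi_weight a b x * f x)"
  using assms weight_measurable_restrict[of a b]
  by (simp add: jacobi_measure_def integral_density jacobi_weight_nonneg integral_restrict_space
      set_lebesgue_integral_def)

text \<open>The substitution \<open>t = (1 - x) / 2\<close> turns the weight into
  \<open>2 powr (a + b)\<close> times the integrand of the Beta function on the unit
  interval.\<close>

lemma jacobi_weight_integral:
  assumes "a > -1" "b > -1"
  shows "set_integrable lborel {-1..1} (jacobi_weight a b)"
    and "(LINT x:{-1..1}|lborel. jacobi_weight a b x) = jacobi_gamma a b"
proof -
  define g where "g = (\<lambda>t::real. indicator {0..1} t *\<^sub>R (t powr a * (1 - t) powr b))"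
  have "set_integrable lborel {0..1} (\<lambda>t::real. t powr a * (1 - t) powr b)"
    using integrable_Beta[of "a + 1" "b + 1"] assms by simp
  then have g: "integrable lborel g" by (simp add: g_def set_integrable_def)
  have "integral\<^sup>L lborel g = integral {0..1} (\<lambda>t::real. t powr a * (1 - t) powr b)"
    using set_borel_integral_eq_integral(2)[of "{0..1::real}" "\<lambda>t. t powr a * (1 - t) powr b"]
      \<open>set_integrable lborel {0..1} _\<close>
    by (simp add: g_def set_lebesgue_integral_def)
  also have "\<dots> = Beta (a + 1) (b + 1)"
    using has_integral_Beta_real[of "a + 1" "b + 1"] assms by (simp add: integral_unique)
  finally have gI: "integral\<^sup>L lborel g = Beta (a + 1) (b + 1)" .
  have eq: "indicator {-1..1} x *\<^sub>R jacobi_weight a b x = 2 powr (a + b) * g (1 / 2 + (- 1 / 2) * x)"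
    for x :: real
  proof (cases "x \<in> {-1..1}")
    case True
    let ?t = "1 / 2 + (- 1 / 2) * x"
    have t: "?t \<in> {0..1}" "1 - x = 2 * ?t" "1 + x = 2 * (1 - ?t)" using True by auto
    have "(1 - x) powr a = 2 powr a * ?t powr a" "(1 + x) powr b = 2 powr b * (1 - ?t) powr b"
      unfolding t(2,3) using t(1) by (simp_all only: powr_mult)
    then show ?thesis using True t(1) by (simp add: g_def jacobi_weight_def powr_add)
  qed (auto simp: g_def indicator_def)
  show "set_integrable lborel {-1..1} (jacobi_weight a b)"
    unfolding set_integrable_def eq
    by (intro integrable_mult_right lborel_integrable_real_affine g) simp
  have "(LINT x:{-1..1}|lborel. jacobi_weight a b x) =
      2 powr (a + b) * (LINT x|lborel. g (1 / 2 + (- 1 / 2) * x))"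
    unfolding set_lebesgue_integral_def eq by simp
  \<comment> \<open>The Jacobian of the substitution supplies the last factor 2 of
    \<open>jacobi_gamma\<close>.\<close>
  also have "(LINT x|lborel. g (1 / 2 + (- 1 / 2) * x)) = 2 * integral\<^sup>L lborel g"
    using lborel_integral_real_affine[of "- 1 / 2" g "1 / 2"] by simp
  finally show "(LINT x:{-1..1}|lborel. jacobi_weight a b x) = jacobi_gamma a b"
    by (simp add: gI jacobi_gamma_def powr_add)
qed

lemma jacobi_gamma_pos:
  assumes "a > -1" "b > -1"
  shows "jacobi_gamma a b > 0"
  using assms unfolding jacobi_gamma_def Beta_def
  by (intro mult_pos_pos divide_pos_pos Gamma_real_pos) auto

text \<open>The weight may be unbounded at the endpoints, but the polynomial is bounded on the
  compact interval, so a multiple of the weight is an integrable majorant.\<close>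

lemma set_integrable_weight_poly:
  assumes "a > -1" "b > -1"
  shows "set_integrable lborel {-1..1} (\<lambda>x. jacobi_weight a b x * poly p x)"
proof -
  have "bounded (poly p ` {-1..1})"
    by (intro compact_imp_bounded compact_continuous_image continuous_intros) auto
  then obtain C where C: "\<And>x. x \<in> {-1..1} \<Longrightarrow> \<bar>poly p x\<bar> \<le> C"
    unfolding bounded_iff by (metis image_eqI real_norm_def)
  have pm: "poly p \<in> borel_measurable borel"
    by (intro borel_measurable_continuous_onI continuous_intros)
  have "set_integrable lborel {-1..1} (\<lambda>x. C * jacobi_weight a b x)"
    using jacobi_weight_integral(1)[OF assms] by (rule set_integrable_mult_right)
  then show ?thesis
    unfolding set_integrable_def
  proof (rule Bochner_Integration.integrable_bound)
    show "(\<lambda>x. indicator {-1..1} x *\<^sub>R (jacobi_weight a b x * poly p x)) \<in> borel_measurable lborel"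
      using pm by measurable
    show "AE x in lborel. norm (indicator {-1..1} x *\<^sub>R (jacobi_weight a b x * poly p x)) \<le>
        norm (indicator {-1..1} x *\<^sub>R (C * jacobi_weight a b x))"
    proof (rule AE_I2)
      fix x :: real
      show "norm (indicator {-1..1} x *\<^sub>R (jacobi_weight a b x * poly p x)) \<le>
        norm (indicator {-1..1} x *\<^sub>R (C * jacobi_weight a b x))"
      proof (cases "x \<in> {-1..1}")
        case True
        then have "jacobi_weight a b x * \<bar>poly p x\<bar> \<le> jacobi_weight a b x * \<bar>C\<bar>"
          using C[OF True] by (intro mult_left_mono jacobi_weight_nonneg) auto
        then show ?thesis using True by (simp add: abs_mult jacobi_weight_nonneg mult.commute)
      qed simp
    qed
  qed
qed

lemma integrable_poly_jacobi:
  assumes "a > -1" "b > -1"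
  shows "integrable (jacobi_measure a b) (poly p)"
  using set_integrable_weight_poly[OF assms] by (simp add: integrable_jacobi_measure_iff)

text \<open>The derivative of \<open>(1 - x)\<^sup>a (1 + x)\<^sup>b u\<close> is \<open>(1 - x)\<^bsup>a-1\<^esup> (1 + x)\<^bsup>b-1\<^esup>\<close> times this polynomial.\<close>
definition jacobi_step :: "real \<Rightarrow> real \<Rightarrow> real poly \<Rightarrow> real poly" where
  "jacobi_step a b u = [:b - a, - a - b:] * u + [:1, 0, -1:] * pderiv u"

lemma jacobi_weight_poly_deriv:
  assumes x: "x \<in> {-1<..<1}"
  shows "((\<lambda>x. jacobi_weight a b x * poly u x) has_field_derivative
    jacobi_weight (a - 1) (b - 1) x * poly (jacobi_step a b u) x) (at x)"
proof -
  have pos: "1 - x > 0" "1 + x > 0" using x by auto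
  have p1: "(1 - x) powr a = (1 - x) powr (a - 1) * (1 - x)"
    and p2: "(1 + x) powr b = (1 + x) powr (b - 1) * (1 + x)"
    using pos by (simp_all add: powr_diff)
  have d1: "((\<lambda>x. (1 - x) powr a) has_field_derivative - a * (1 - x) powr (a - 1)) (at x)"
    and d2: "((\<lambda>x. (1 + x) powr b) has_field_derivative b * (1 + x) powr (b - 1)) (at x)"
    using pos by (auto intro!: derivative_eq_intros simp: powr_diff)
  show ?thesis
    unfolding jacobi_weight_def
    by (rule DERIV_cong[OF DERIV_mult[OF DERIV_mult[OF d1 d2] poly_DERIV]])
      (simp add: jacobi_step_def p1 p2 algebra_simps)
qed

text \<open>Positive exponents make the antiderivative vanish at both endpoints. Its derivative may
  blow up there, as the exponents \<open>a - 1\<close> and \<open>b - 1\<close> can be negative;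
  hence the fundamental theorem is used in the form that asks for derivatives only in the
  interior.\<close>

lemma integral_jacobi_step:
  assumes "a > 0" "b > 0"
  shows "(LINT x|jacobi_measure (a - 1) (b - 1). poly (jacobi_step a b u) x) = 0"
proof -
  let ?F = "\<lambda>x. jacobi_weight a b x * poly u x"
  let ?f = "\<lambda>x. jacobi_weight (a - 1) (b - 1) x * poly (jacobi_step a b u) x"
  have "continuous_on {-1..1} ?F"
    unfolding jacobi_weight_def using assms
    by (intro continuous_intros continuous_on_powr') auto
  then have "(?f has_integral (?F 1 - ?F (-1))) {-1..1}"
    using jacobi_weight_poly_deriv
    by (intro fundamental_theorem_of_calculus_interior)
      (auto simp: has_real_derivative_iff_has_vector_derivative)
  then have "integral {-1..1} ?f = 0"
    by (simp add: integral_unique jacobi_weight_def)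
  then show ?thesis
    using set_borel_integral_eq_integral(2)[OF set_integrable_weight_poly[of "a - 1" "b - 1" "jacobi_step a b u"]]
      assms by (simp add: integral_jacobi_measure)
qed

text \<open>The factor \<open>1 - x^2 = (1 - x) (1 + x)\<close> is absorbed into the weight.\<close>

lemma integral_jacobi_shift:
  assumes "a > -1" "b > -1"
  shows "(LINT x|jacobi_measure a b. poly ([:1, 0, -1:] * u) x) =
    (LINT x|jacobi_measure (a + 1) (b + 1). poly u x)"
proof -
  have "jacobi_weight a b x * poly ([:1, 0, -1:] * u) x = jacobi_weight (a + 1) (b + 1) x * poly u x"
    if "x \<in> {-1..1}" for x
  proof -
    have "(1 - x) powr (a + 1) = (1 - x) * (1 - x) powr a"
      and "(1 + x) powr (b + 1) = (1 + x) * (1 + x) powr b"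
      using that powr_mult_base[of "1 - x" a] powr_mult_base[of "1 + x" b] by (simp_all add: add.commute)
    then show ?thesis by (simp add: jacobi_weight_def) (simp add: algebra_simps)
  qed
  then show ?thesis
    unfolding integral_jacobi_measure[OF measurable_poly_jacobi]
    by (intro set_lebesgue_integral_cong) auto
qed

text \<open>Integration by parts: the product rule writes \<open>jacobi_step a b (q * u)\<close>,
  whose integral is 0, as \<open>q * jacobi_step a b u\<close> plus \<open>(1 - x^2) q' u\<close>,
  and the factor \<open>1 - x^2\<close> raises the exponents.\<close>

lemma integral_mult_jacobi_step:
  assumes "a > 0" "b > 0"
  shows "(LINT x|jacobi_measure (a - 1) (b - 1). poly (q * jacobi_step a b u) x) =
    - (LINT x|jacobi_measure a b. poly (pderiv q * u) x)"
proof -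
  have "jacobi_step a b (q * u) = q * jacobi_step a b u + [:1, 0, -1:] * (pderiv q * u)"
    by (simp add: jacobi_step_def pderiv_mult algebra_simps)
  then have "0 = (LINT x|jacobi_measure (a - 1) (b - 1).
      poly (q * jacobi_step a b u) x + poly ([:1, 0, -1:] * (pderiv q * u)) x)"
    using integral_jacobi_step[OF assms, of "q * u"] by (simp only: poly_add)
  also have "\<dots> = (LINT x|jacobi_measure (a - 1) (b - 1). poly (q * jacobi_step a b u) x) +
      (LINT x|jacobi_measure (a - 1) (b - 1). poly ([:1, 0, -1:] * (pderiv q * u)) x)"
    using assms by (intro Bochner_Integration.integral_add integrable_poly_jacobi) auto
  also have "(LINT x|jacobi_measure (a - 1) (b - 1). poly ([:1, 0, -1:] * (pderiv q * u)) x) =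
      (LINT x|jacobi_measure a b. poly (pderiv q * u) x)"
    using integral_jacobi_shift[of "a - 1" "b - 1" "pderiv q * u"] assms by simp
  finally show ?thesis by simp
qed

text \<open>The polynomial factor left after \<open>j\<close> of the derivatives in Rodrigues'
  formula; each derivative lowers both exponents of the weight by one. Real subtraction keeps the
  recursion meaningful for every \<open>j\<close>, and its explicit form gives access to degrees and
  coefficients.\<close>

primrec rodrigues_poly :: "real \<Rightarrow> real \<Rightarrow> nat \<Rightarrow> nat \<Rightarrow> real poly" where
  "rodrigues_poly \<alpha> \<beta> k 0 = 1"
| "rodrigues_poly \<alpha> \<beta> k (Suc j) =
    jacobi_step (\<alpha> + real k - real j) (\<beta> + real k - real j) (rodrigues_poly \<alpha> \<beta> k j)"

lemma iterated_deriv_rodrigues_poly: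
  assumes "x \<in> {-1<..<1}"
  shows "(deriv ^^ j) (\<lambda>t. jacobi_weight \<alpha> \<beta> t * (1 - t\<^sup>2) ^ k) x =
    jacobi_weight (\<alpha> + real k - real j) (\<beta> + real k - real j) x * poly (rodrigues_poly \<alpha> \<beta> k j) x"
  using assms
proof (induction j arbitrary: x)
  case 0
  then have "(1 - x\<^sup>2) ^ k = (1 - x) powr real k * (1 + x) powr real k"
    by (simp add: powr_realpow power_mult_distrib[symmetric])
      (simp add: algebra_simps power2_eq_square)
  then show ?case by (simp add: jacobi_weight_def powr_add)
next
  case (Suc j)
  let ?F = "(deriv ^^ j) (\<lambda>t. jacobi_weight \<alpha> \<beta> t * (1 - t\<^sup>2) ^ k)"
  have "(?F has_field_derivative jacobi_weight (\<alpha> + real k - real j - 1) (\<beta> + real k - real j - 1) x *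
      poly (jacobi_step (\<alpha> + real k - real j) (\<beta> + real k - real j) (rodrigues_poly \<alpha> \<beta> k j)) x) (at x)"
    by (rule has_field_derivative_transform_within_open[OF jacobi_weight_poly_deriv[OF Suc.prems],
        of "{-1<..<1}"]) (use Suc in auto)
  then show ?case by (simp add: DERIV_imp_deriv diff_diff_eq add.commute)
qed

text \<open>Rodrigues' formula is available only inside the interval; infinitely many points of
  agreement suffice to identify the polynomials.\<close>

lemma poly_eqI_open_interval:
  fixes p q :: "real poly"
  assumes "\<And>x. x \<in> {-1<..<1} \<Longrightarrow> poly p x = poly q x"
  shows "p = q"
proof (rule ccontr)
  assume "p \<noteq> q"
  then have "finite {x. poly (p - q) x = 0}" by (intro poly_roots_finite) simp
  then have "finite {-1<..<1::real}" by (rule rev_finite_subset) (use assms in auto)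
  then show False using infinite_Ioo[of "-1::real" 1] by simp
qed

text \<open>After \<open>k\<close> derivatives the exponents are back at \<alpha> and \<beta>, and
  the weight cancels against its reciprocal in Rodrigues' formula.\<close>

lemma jacobi_poly_eq:
  "jacobi_poly \<alpha> \<beta> k = Polynomial.smult ((-1) ^ k / (2 ^ k * fact k)) (rodrigues_poly \<alpha> \<beta> k k)"
proof (rule poly_eqI_open_interval)
  fix x :: real assume x: "x \<in> {-1<..<1}"
  then have "jacobi_weight \<alpha> \<beta> x > 0" by (simp add: jacobi_weight_def)
  then show "poly (jacobi_poly \<alpha> \<beta> k) x =
      poly (Polynomial.smult ((-1) ^ k / (2 ^ k * fact k)) (rodrigues_poly \<alpha> \<beta> k k)) x"
    by (simp add: poly_jacobi_poly[OF x] rodrigues_def iterated_deriv_rodrigues_poly[OF x])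
qed

text \<open>Integrating by parts \<open>j\<close> times moves all derivatives to \<open>q\<close>;
  each time the sign changes and both exponents grow by one. The condition \<open>j \<le> k\<close>
  keeps the exponents positive, so that no boundary terms appear.\<close>

lemma integral_mult_rodrigues_poly:
  assumes "\<alpha> > -1" "\<beta> > -1" "j \<le> k"
  shows "(LINT x|jacobi_measure (\<alpha> + real (k - j)) (\<beta> + real (k - j)). poly (q * rodrigues_poly \<alpha> \<beta> k j) x) =
    (-1) ^ j * (LINT x|jacobi_measure (\<alpha> + real k) (\<beta> + real k). poly ((pderiv ^^ j) q) x)"
  using assms(3)
proof (induction j arbitrary: q)
  case (Suc j)
  let ?a = "\<alpha> + real k - real j" and ?b = "\<beta> + real k - real j"
  have ab: "?a > 0" "?b > 0" using assms(1,2) Suc.prems by linarith+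
  have e: "\<alpha> + real (k - Suc j) = ?a - 1" "\<beta> + real (k - Suc j) = ?b - 1"
    "\<alpha> + real (k - j) = ?a" "\<beta> + real (k - j) = ?b"
    using Suc.prems by auto
  show ?case
    using integral_mult_jacobi_step[OF ab, of q "rodrigues_poly \<alpha> \<beta> k j"] Suc.IH[of "pderiv q"] Suc.prems
    unfolding e by (simp add: funpow_swap1)
qed simp

text \<open>The sign from \<open>k\<close> integrations by parts cancels the one in Rodrigues'
  formula. Both the orthogonality and the norms follow from this identity.\<close>

lemma integral_mult_jacobi_poly:
  assumes "\<alpha> > -1" "\<beta> > -1"
  shows "(LINT x|jacobi_measure \<alpha> \<beta>. poly (q * jacobi_poly \<alpha> \<beta> k) x) =
    (LINT x|jacobi_measure (\<alpha> + real k) (\<beta> + real k). poly ((pderiv ^^ k) q) x) / (2 ^ k * fact k)"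
proof -
  have "(-1) ^ k * ((-1) ^ k :: real) = 1" by (simp flip: power_mult_distrib)
  then show ?thesis
    using integral_mult_rodrigues_poly[OF assms order_refl, of k q]
    by (simp add: jacobi_poly_eq)
qed

section \<open>Degrees, leading coefficients and norms of the Jacobi polynomials\<close>

lemma coeff_jacobi_step:
  "coeff (jacobi_step a b u) (Suc d) =
    (b - a) * coeff u (Suc d) - (a + b + real d) * coeff u d + (real d + 2) * coeff u (Suc (Suc d))"
proof -
  have "jacobi_step a b u = Polynomial.smult (b - a) u + pCons 0 (Polynomial.smult (- a - b) u) +
      pderiv u - pCons 0 (pCons 0 (pderiv u))"
    by (simp add: jacobi_step_def)
  show ?thesis
    unfolding \<open>jacobi_step a b u = _\<close> by (cases d) (simp_all add: coeff_pderiv algebra_simps)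
qed

lemma coeff_jacobi_step_Suc:
  assumes "degree u \<le> d"
  shows "coeff (jacobi_step a b u) (Suc d) = - (a + b + real d) * coeff u d"
proof -
  have "coeff u (Suc d) = 0" "coeff u (Suc (Suc d)) = 0"
    using assms by (simp_all add: coeff_eq_0)
  then show ?thesis by (simp add: coeff_jacobi_step algebra_simps)
qed

lemma degree_jacobi_step:
  assumes "degree u \<le> d"
  shows "degree (jacobi_step a b u) \<le> Suc d"
proof (rule degree_le, intro allI impI)
  fix i assume "Suc d < i"
  then obtain i' where i: "i = Suc i'" "d < i'" by (cases i) auto
  then have "coeff u i' = 0" "coeff u (Suc i') = 0" "coeff u (Suc (Suc i')) = 0"
    using assms by (simp_all add: coeff_eq_0)
  then show "coeff (jacobi_step a b u) i = 0" by (simp add: i(1) coeff_jacobi_step)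
qed

lemma degree_rodrigues_poly: "degree (rodrigues_poly \<alpha> \<beta> k j) \<le> j"
  by (induction j) (simp_all add: degree_jacobi_step)

text \<open>At step \<open>j\<close> the two exponents add up to
  \<open>\<alpha> + \<beta> + 2 k - 2 j\<close> and the polynomial has degree at most
  \<open>j\<close>, so the top coefficient is multiplied by
  \<open>- (\<alpha> + \<beta> + 2 k - j)\<close>.\<close>

lemma coeff_rodrigues_poly:
  "coeff (rodrigues_poly \<alpha> \<beta> k j) j = (-1) ^ j * (\<Prod>i<j. \<alpha> + \<beta> + 2 * real k - real i)"
proof (induction j)
  case (Suc j)
  have "coeff (rodrigues_poly \<alpha> \<beta> k (Suc j)) (Suc j) =
      - (\<alpha> + \<beta> + 2 * real k - real j) * coeff (rodrigues_poly \<alpha> \<beta> k j) j"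
    by (simp add: coeff_jacobi_step_Suc[OF degree_rodrigues_poly])
  then show ?case
    by (simp only: Suc prod.lessThan_Suc power_Suc mult_minus_left mult_minus_right mult_1_left mult_ac)
qed simp

lemma degree_jacobi_poly: "degree (jacobi_poly \<alpha> \<beta> k) \<le> k"
  unfolding jacobi_poly_eq by (rule order_trans[OF degree_smult_le degree_rodrigues_poly])

lemma funpow_pderiv_degree_le:
  fixes q :: "real poly"
  assumes "degree q \<le> k"
  shows "(pderiv ^^ k) q = [:fact k * coeff q k:]"
  using assms
proof (induction k arbitrary: q)
  case 0
  then have "degree q = 0" by simp
  then obtain c where "q = [:c:]" by (rule degree_eq_zeroE)
  then show ?case by simp
next
  case (Suc k)
  have "degree (pderiv q) \<le> k" using Suc.prems by (simp add: degree_pderiv)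
  from Suc.IH[OF this] have "(pderiv ^^ Suc k) q = [:fact k * coeff (pderiv q) k:]"
    by (simp only: funpow_Suc_right o_apply)
  also have "\<dots> = [:fact (Suc k) * coeff q (Suc k):]"
    by (simp only: coeff_pderiv fact_Suc of_nat_mult mult_ac)
  finally show ?case .
qed

lemma measure_jacobi_measure:
  assumes "a > -1" "b > -1"
  shows "measure (jacobi_measure a b) {-1..1} = jacobi_gamma a b"
proof -
  have "(LINT x|jacobi_measure a b. 1) = jacobi_gamma a b"
    by (subst integral_jacobi_measure) (simp_all add: jacobi_weight_integral[OF assms])
  then show ?thesis by simp
qed

lemma poly_const_eq: "poly [:c:] = (\<lambda>x. c)"
  by (simp add: fun_eq_iff)

lemma poly_mult_eq: "poly (p * q) = (\<lambda>x. poly p x * poly q x)"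
  by (simp add: fun_eq_iff)

lemma integral_jacobi_poly_less:
  assumes "\<alpha> > -1" "\<beta> > -1" "degree q < k"
  shows "(LINT x|jacobi_measure \<alpha> \<beta>. poly (q * jacobi_poly \<alpha> \<beta> k) x) = 0"
  unfolding integral_mult_jacobi_poly[OF assms(1,2)] funpow_pderiv_degree_le[OF less_imp_le[OF assms(3)]]
  using assms(3) by (simp add: coeff_eq_0 poly_const_eq del: pCons_0_0)

text \<open>The product is the rising factorial of \<open>x + k + 1\<close> with its
  \<open>k\<close> factors in reverse order.\<close>

lemma prod_mult_Gamma:
  fixes x :: real
  assumes "x + real k + 1 > 0"
  shows "(\<Prod>i<k. x + 2 * real k - real i) * Gamma (x + real k + 1) = Gamma (x + 2 * real k + 1)"
proof -
  have "(\<Prod>i<k. x + 2 * real k - real i) = pochhammer (x + real k + 1) k"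
    unfolding pochhammer_prod_rev by (rule prod.reindex_bij_witness[of _ "\<lambda>i. i - 1" "\<lambda>i. i + 1"]) auto
  also have "\<dots> * Gamma (x + real k + 1) = Gamma (x + 2 * real k + 1)"
  proof -
    have "x + real k + 1 \<notin> \<int>\<^sub>\<le>\<^sub>0" using assms by (auto elim!: nonpos_Ints_cases)
    moreover have "Gamma (x + real k + 1) \<noteq> 0" using Gamma_real_pos[OF assms] by simp
    ultimately show ?thesis by (simp add: pochhammer_Gamma algebra_simps)
  qed
  finally show ?thesis .
qed

text \<open>The \<open>k\<close>-th derivative of the Jacobi polynomial is the constant
  \<open>fact k\<close> times its top coefficient, so the integral reduces to that coefficient and
  the total mass \<open>jacobi_gamma (\<alpha> + k) (\<beta> + k)\<close>. The rest is arithmetic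
  with Gamma values.\<close>

lemma integral_jacobi_poly_square:
  assumes "\<alpha> > -1" "\<beta> > -1"
  shows "(LINT x|jacobi_measure \<alpha> \<beta>. poly (jacobi_poly \<alpha> \<beta> k * jacobi_poly \<alpha> \<beta> k) x) = jacobi_h \<alpha> \<beta> k"
proof -
  define P where "P = (\<Prod>i<k. \<alpha> + \<beta> + 2 * real k - real i)"
  have "coeff (jacobi_poly \<alpha> \<beta> k) k = P / (2 ^ k * fact k)"
    by (simp add: jacobi_poly_eq coeff_rodrigues_poly P_def)
  then have "(LINT x|jacobi_measure \<alpha> \<beta>. poly (jacobi_poly \<alpha> \<beta> k * jacobi_poly \<alpha> \<beta> k) x) =
      P * jacobi_gamma (\<alpha> + real k) (\<beta> + real k) / (2 ^ k * 2 ^ k * fact k)"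
    unfolding integral_mult_jacobi_poly[OF assms] funpow_pderiv_degree_le[OF degree_jacobi_poly]
    using assms by (simp add: measure_jacobi_measure poly_const_eq mult.assoc mult.commute)
  also have "\<dots> = jacobi_h \<alpha> \<beta> k"
  proof (cases "k = 0")
    case True
    then show ?thesis by (simp add: P_def jacobi_gamma_def jacobi_h_def Beta_def add_ac)
  next
    case False
    \<comment> \<open>This uses \<open>k \<ge> 1\<close>: for \<open>k = 0\<close> the sum can be
      zero or negative, which is why that case is separate.\<close>
    have x: "\<alpha> + \<beta> + real k + 1 > 0" using assms False by linarith
    have G: "Gamma (\<alpha> + \<beta> + real k + 1) > 0" using x by (rule Gamma_real_pos)
    have z: "\<alpha> + \<beta> + 2 * real k + 1 > 0" using assms False by linarith
    have PG: "P = Gamma (\<alpha> + \<beta> + 2 * real k + 1) / Gamma (\<alpha> + \<beta> + real k + 1)"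
      using prod_mult_Gamma[OF x] G by (simp add: P_def field_simps)
    have "Gamma (\<alpha> + \<beta> + 2 * real k + 2) =
        (\<alpha> + \<beta> + 2 * real k + 1) * Gamma (\<alpha> + \<beta> + 2 * real k + 1)"
    proof -
      have "\<alpha> + \<beta> + 2 * real k + 1 \<notin> \<int>\<^sub>\<le>\<^sub>0" using z by (auto elim!: nonpos_Ints_cases)
      from Gamma_plus1[OF this] show ?thesis by (simp add: add_ac)
    qed
    moreover have "Gamma (\<alpha> + \<beta> + 2 * real k + 1) \<noteq> 0" using Gamma_real_pos[OF z] by simp
    moreover have "2 powr (\<alpha> + \<beta> + 2 * real k + 1) = 2 powr (\<alpha> + \<beta> + 1) * (2 ^ k * 2 ^ k)"
    proof -
      have "2 powr (\<alpha> + \<beta> + 2 * real k + 1) = 2 powr ((\<alpha> + \<beta> + 1) + real k + real k)"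
        by (simp add: algebra_simps)
      also have "\<dots> = 2 powr (\<alpha> + \<beta> + 1) * 2 powr real k * 2 powr real k"
        by (simp only: powr_add)
      finally show ?thesis by (simp add: powr_realpow)
    qed
    moreover have "jacobi_gamma (\<alpha> + real k) (\<beta> + real k) = 2 powr (\<alpha> + \<beta> + 2 * real k + 1) *
        (Gamma (real k + \<alpha> + 1) * Gamma (real k + \<beta> + 1) / Gamma (\<alpha> + \<beta> + 2 * real k + 2))"
      by (simp add: jacobi_gamma_def Beta_def algebra_simps)
    moreover have "jacobi_h \<alpha> \<beta> k = 2 powr (\<alpha> + \<beta> + 1) * Gamma (real k + \<alpha> + 1) * Gamma (real k + \<beta> + 1) /
     (fact k * ((\<alpha> + \<beta> + 2 * real k + 1) * Gamma (\<alpha> + \<beta> + real k + 1)))"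
      using False by (simp add: jacobi_h_def add_ac)
    ultimately show ?thesis using G z unfolding PG by (simp add: mult_ac)
  qed
  finally show ?thesis .
qed

lemma jacobi_h_pos:
  assumes "\<alpha> > -1" "\<beta> > -1"
  shows "jacobi_h \<alpha> \<beta> k > 0"
proof (cases "k = 0")
  case True
  then show ?thesis unfolding jacobi_h_def using assms
    by (auto intro!: mult_pos_pos divide_pos_pos Gamma_real_pos)
next
  case False
  then show ?thesis unfolding jacobi_h_def using assms
    by (auto intro!: mult_pos_pos divide_pos_pos Gamma_real_pos)
qed

lemma jacobi_h_0: "jacobi_h \<alpha> \<beta> 0 = jacobi_gamma \<alpha> \<beta>"
  by (simp add: jacobi_gamma_def jacobi_h_def Beta_def add_ac)

lemma normalized_jacobi_0: "normalized_jacobi \<alpha> \<beta> 0 = [:1 / sqrt (jacobi_gamma \<alpha> \<beta>):]"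
  by (simp add: normalized_jacobi_def jacobi_h_0 jacobi_poly_eq one_pCons)

lemma degree_normalized_jacobi: "degree (normalized_jacobi \<alpha> \<beta> k) \<le> k"
  unfolding normalized_jacobi_def by (rule order_trans[OF degree_smult_le degree_jacobi_poly])

text \<open>By symmetry the factor of smaller degree can play the role of \<open>q\<close>, whose
  derivatives of the higher order vanish.\<close>

lemma normalized_jacobi_orthonormal:
  assumes "\<alpha> > -1" "\<beta> > -1"
  shows "weighted_inner \<alpha> \<beta> (poly (normalized_jacobi \<alpha> \<beta> j)) (poly (normalized_jacobi \<alpha> \<beta> k)) =
    (if j = k then 1 else 0)"
proof -
  have less: "(LINT x|jacobi_measure \<alpha> \<beta>. poly (jacobi_poly \<alpha> \<beta> j) x * poly (jacobi_poly \<alpha> \<beta> k) x) = 0"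
    if "j < k" for j k
    using integral_jacobi_poly_less[OF assms, of "jacobi_poly \<alpha> \<beta> j" k] degree_jacobi_poly[of \<alpha> \<beta> j] that
    by simp
  have "weighted_inner \<alpha> \<beta> (poly (normalized_jacobi \<alpha> \<beta> j)) (poly (normalized_jacobi \<alpha> \<beta> k)) =
    (LINT x|jacobi_measure \<alpha> \<beta>. poly (jacobi_poly \<alpha> \<beta> j) x * poly (jacobi_poly \<alpha> \<beta> k) x) /
      (sqrt (jacobi_h \<alpha> \<beta> j) * sqrt (jacobi_h \<alpha> \<beta> k))"
    by (simp add: weighted_inner_def normalized_jacobi_def)
  then show ?thesis
    using integral_jacobi_poly_square[OF assms, of k] less[of j k] less[of k j] jacobi_h_pos[OF assms, of k]
    by (cases j k rule: linorder_cases) (simp_all add: mult.commute)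
qed

section \<open>Finite Jacobi expansions and orthogonal projection\<close>

definition jacobi_comb :: "real \<Rightarrow> real \<Rightarrow> nat \<Rightarrow> (nat \<Rightarrow> real) \<Rightarrow> real poly" where
  "jacobi_comb \<alpha> \<beta> N c = (\<Sum>k\<le>N. Polynomial.smult (c k) (normalized_jacobi \<alpha> \<beta> k))"

lemma poly_jacobi_comb:
  "poly (jacobi_comb \<alpha> \<beta> N c) x = (\<Sum>k\<le>N. c k * poly (normalized_jacobi \<alpha> \<beta> k) x)"
  by (simp add: jacobi_comb_def poly_sum)

lemma degree_jacobi_comb: "degree (jacobi_comb \<alpha> \<beta> N c) \<le> N"
  unfolding jacobi_comb_def
  by (intro degree_sum_le) (auto intro: order_trans[OF degree_smult_le] order_trans[OF degree_normalized_jacobi])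

lemma jacobi_span_eq: "jacobi_span \<alpha> \<beta> N = range (jacobi_comb \<alpha> \<beta> N)"
  by (auto simp: jacobi_span_def jacobi_comb_def)

lemma poly_weighted_L2:
  assumes "\<alpha> > -1" "\<beta> > -1"
  shows "poly p \<in> weighted_L2 \<alpha> \<beta>"
  using integrable_poly_jacobi[OF assms, of "p * p"] by (simp add: weighted_L2_def power2_eq_square poly_mult_eq)

text \<open>The bound \<open>2 |f g| \<le> f^2 + g^2\<close> provides an integrable
  majorant.\<close>

lemma weighted_L2_integrable_mult:
  assumes "f \<in> weighted_L2 \<alpha> \<beta>" "g \<in> weighted_L2 \<alpha> \<beta>"
  shows "integrable (jacobi_measure \<alpha> \<beta>) (\<lambda>x. f x * g x)"
proof (rule Bochner_Integration.integrable_bound)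
  show "integrable (jacobi_measure \<alpha> \<beta>) (\<lambda>x. (f x)\<^sup>2 + (g x)\<^sup>2)"
    using assms by (simp add: weighted_L2_def)
  show "(\<lambda>x. f x * g x) \<in> borel_measurable (jacobi_measure \<alpha> \<beta>)"
    using assms by (intro borel_measurable_times) (simp_all add: weighted_L2_def)
  show "AE x in jacobi_measure \<alpha> \<beta>. norm (f x * g x) \<le> norm ((f x)\<^sup>2 + (g x)\<^sup>2)"
  proof (rule AE_I2)
    fix x
    have "2 * (\<bar>f x\<bar> * \<bar>g x\<bar>) \<le> (f x)\<^sup>2 + (g x)\<^sup>2"
      using sum_squares_bound[of "\<bar>f x\<bar>" "\<bar>g x\<bar>"] by simp
    moreover have "0 \<le> \<bar>f x\<bar> * \<bar>g x\<bar>" by simp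
    ultimately show "norm (f x * g x) \<le> norm ((f x)\<^sup>2 + (g x)\<^sup>2)"
      unfolding real_norm_def abs_mult by linarith
  qed
qed

lemma weighted_inner_commute: "weighted_inner \<alpha> \<beta> f g = weighted_inner \<alpha> \<beta> g f"
  by (simp add: weighted_inner_def mult.commute)

lemma weighted_L2_diff:
  assumes "f \<in> weighted_L2 \<alpha> \<beta>" "g \<in> weighted_L2 \<alpha> \<beta>"
  shows "(\<lambda>x. f x - g x) \<in> weighted_L2 \<alpha> \<beta>"
proof -
  have "(\<lambda>x. (f x - g x)\<^sup>2) = (\<lambda>x. (f x)\<^sup>2 + (g x)\<^sup>2 - 2 * (f x * g x))"
    by (simp add: power2_diff mult.assoc)
  moreover have "(\<lambda>x. f x - g x) \<in> borel_measurable (jacobi_measure \<alpha> \<beta>)"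
    using assms by (intro borel_measurable_diff) (simp_all add: weighted_L2_def)
  ultimately show ?thesis
    using assms weighted_L2_integrable_mult[OF assms] by (simp add: weighted_L2_def)
qed

lemma weighted_inner_diff_left:
  assumes "f \<in> weighted_L2 \<alpha> \<beta>" "g \<in> weighted_L2 \<alpha> \<beta>" "h \<in> weighted_L2 \<alpha> \<beta>"
  shows "weighted_inner \<alpha> \<beta> (\<lambda>x. f x - g x) h = weighted_inner \<alpha> \<beta> f h - weighted_inner \<alpha> \<beta> g h"
  using weighted_L2_integrable_mult[OF assms(1,3)] weighted_L2_integrable_mult[OF assms(2,3)]
  by (simp add: weighted_inner_def left_diff_distrib)

lemma weighted_norm_square:
  "(weighted_norm \<alpha> \<beta> f)\<^sup>2 = weighted_inner \<alpha> \<beta> f f"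
  by (simp add: weighted_norm_def weighted_inner_def power2_eq_square)

lemma weighted_norm_nonneg: "weighted_norm \<alpha> \<beta> f \<ge> 0"
  by (simp add: weighted_norm_def)

context
  fixes \<alpha> \<beta> :: real
  assumes ab: "\<alpha> > -1" "\<beta> > -1"
begin

lemma weighted_inner_jacobi_comb:
  assumes "f \<in> weighted_L2 \<alpha> \<beta>"
  shows "weighted_inner \<alpha> \<beta> f (poly (jacobi_comb \<alpha> \<beta> N c)) =
    (\<Sum>k\<le>N. c k * weighted_inner \<alpha> \<beta> f (poly (normalized_jacobi \<alpha> \<beta> k)))"
proof -
  have "weighted_inner \<alpha> \<beta> f (poly (jacobi_comb \<alpha> \<beta> N c)) =
      (LINT x|jacobi_measure \<alpha> \<beta>. (\<Sum>k\<le>N. c k * (f x * poly (normalized_jacobi \<alpha> \<beta> k) x)))"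
    by (simp add: weighted_inner_def poly_jacobi_comb sum_distrib_left mult.left_commute)
  also have "\<dots> = (\<Sum>k\<le>N. (LINT x|jacobi_measure \<alpha> \<beta>. c k * (f x * poly (normalized_jacobi \<alpha> \<beta> k) x)))"
    using weighted_L2_integrable_mult[OF assms poly_weighted_L2[OF ab]]
    by (intro Bochner_Integration.integral_sum integrable_mult_right) auto
  finally show ?thesis by (simp add: weighted_inner_def)
qed

lemma weighted_inner_comb_normalized:
  assumes "k \<le> N"
  shows "weighted_inner \<alpha> \<beta> (poly (jacobi_comb \<alpha> \<beta> N c)) (poly (normalized_jacobi \<alpha> \<beta> k)) = c k"
  using weighted_inner_jacobi_comb[OF poly_weighted_L2[OF ab], of "normalized_jacobi \<alpha> \<beta> k" N c] assms
  by (simp add: weighted_inner_commute[of _ _ "poly (jacobi_comb _ _ _ _)"] normalized_jacobi_orthonormal[OF ab]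
      if_distrib cong: if_cong)

lemma weighted_norm_jacobi_comb:
  "(weighted_norm \<alpha> \<beta> (poly (jacobi_comb \<alpha> \<beta> N c)))\<^sup>2 = (\<Sum>k\<le>N. (c k)\<^sup>2)"
  unfolding weighted_norm_square weighted_inner_jacobi_comb[OF poly_weighted_L2[OF ab]]
  by (simp add: weighted_inner_comb_normalized power2_eq_square)

text \<open>Linear independence: the inner product with the \<open>k\<close>-th normalized
  polynomial reads off \<open>c k\<close>.\<close>

lemma jacobi_comb_eq_0:
  assumes "jacobi_comb \<alpha> \<beta> N c = 0" "k \<le> N"
  shows "c k = 0"
  using weighted_inner_comb_normalized[OF assms(2), of c] by (simp add: assms(1) weighted_inner_def)

text \<open>The Fourier coefficients \<open>c\<close> of \<open>f\<close> give a residual orthogonal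
  to the span. Any other candidate with coefficients \<open>e\<close> is tested against the
  combination with coefficients \<open>c - e\<close>, so the sum of the squares of
  \<open>c k - e k\<close> is 0; this uniqueness determines the description operator in
  \<open>jacobi_proj\<close>.\<close>

lemma jacobi_proj_exists:
  assumes f: "f \<in> weighted_L2 \<alpha> \<beta>"
  shows "\<exists>c. jacobi_proj \<alpha> \<beta> N f = jacobi_comb \<alpha> \<beta> N c \<and>
    (\<forall>d. weighted_inner \<alpha> \<beta> (\<lambda>x. f x - poly (jacobi_comb \<alpha> \<beta> N c) x) (poly (jacobi_comb \<alpha> \<beta> N d)) = 0)"
proof -
  define c where "c k = weighted_inner \<alpha> \<beta> f (poly (normalized_jacobi \<alpha> \<beta> k))" for k
  let ?Q = "\<lambda>p. p \<in> jacobi_span \<alpha> \<beta> N \<and>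
     (\<forall>q\<in>jacobi_span \<alpha> \<beta> N. weighted_inner \<alpha> \<beta> (\<lambda>x. f x - poly p x) (poly q) = 0)"
  have inner: "weighted_inner \<alpha> \<beta> (\<lambda>x. f x - poly (jacobi_comb \<alpha> \<beta> N e) x) (poly (jacobi_comb \<alpha> \<beta> N d)) =
      (\<Sum>k\<le>N. d k * (c k - e k))" for d e
    unfolding weighted_inner_jacobi_comb[OF weighted_L2_diff[OF f poly_weighted_L2[OF ab]]]
    by (intro sum.cong refl arg_cong2[where f = "(*)"])
      (simp add: weighted_inner_diff_left[OF f poly_weighted_L2[OF ab] poly_weighted_L2[OF ab]]
        weighted_inner_comb_normalized c_def)
  have ex: "?Q (jacobi_comb \<alpha> \<beta> N c)" by (auto simp: jacobi_span_eq inner)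
  have "p = jacobi_comb \<alpha> \<beta> N c" if Qp: "?Q p" for p
  proof -
    obtain e where e: "p = jacobi_comb \<alpha> \<beta> N e" using Qp unfolding jacobi_span_eq by blast
    have "weighted_inner \<alpha> \<beta> (\<lambda>x. f x - poly (jacobi_comb \<alpha> \<beta> N e) x)
        (poly (jacobi_comb \<alpha> \<beta> N (\<lambda>k. c k - e k))) = 0"
      using Qp unfolding e by (simp add: jacobi_span_eq)
    then have "(\<Sum>k\<le>N. (c k - e k) * (c k - e k)) = 0" by (simp only: inner)
    then have "\<forall>k\<in>{..N}. (c k - e k) * (c k - e k) = 0"
      by (subst (asm) sum_nonneg_eq_0_iff) auto
    then show ?thesis unfolding e jacobi_comb_def by (intro sum.cong) auto
  qed
  then have "jacobi_proj \<alpha> \<beta> N f = jacobi_comb \<alpha> \<beta> N c"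
    unfolding jacobi_proj_def using ex by (rule the_equality[rotated])
  then show ?thesis using inner by (intro exI[of _ c]) simp
qed

text \<open>The error is the orthogonal sum of the projection residual and an element of the span,
  whose norm is the Euclidean distance of the coefficients. Pythagoras gives the sum of the squares,
  which is at most the square of the sum.\<close>

lemma weighted_norm_diff_comb_le:
  assumes f: "f \<in> weighted_L2 \<alpha> \<beta>"
    and orth: "\<And>d. weighted_inner \<alpha> \<beta> (\<lambda>x. f x - poly (jacobi_comb \<alpha> \<beta> N c) x) (poly (jacobi_comb \<alpha> \<beta> N d)) = 0"
  shows "weighted_norm \<alpha> \<beta> (\<lambda>x. f x - poly (jacobi_comb \<alpha> \<beta> N d) x) \<le>
    weighted_norm \<alpha> \<beta> (\<lambda>x. f x - poly (jacobi_comb \<alpha> \<beta> N c) x) + sqrt (\<Sum>k\<le>N. (c k - d k)\<^sup>2)"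
proof -
  let ?g = "\<lambda>x. f x - poly (jacobi_comb \<alpha> \<beta> N c) x"
  let ?q = "jacobi_comb \<alpha> \<beta> N (\<lambda>k. d k - c k)"
  have g: "?g \<in> weighted_L2 \<alpha> \<beta>" by (rule weighted_L2_diff[OF f poly_weighted_L2[OF ab]])
  have q: "poly ?q \<in> weighted_L2 \<alpha> \<beta>" by (rule poly_weighted_L2[OF ab])
  have eq: "(\<lambda>x. f x - poly (jacobi_comb \<alpha> \<beta> N d) x) = (\<lambda>x. ?g x - poly ?q x)"
    by (simp add: poly_jacobi_comb left_diff_distrib sum_subtractf)
  have "(weighted_norm \<alpha> \<beta> (\<lambda>x. f x - poly (jacobi_comb \<alpha> \<beta> N d) x))\<^sup>2 =
      weighted_inner \<alpha> \<beta> ?g (\<lambda>x. ?g x - poly ?q x) - weighted_inner \<alpha> \<beta> (poly ?q) (\<lambda>x. ?g x - poly ?q x)"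
    unfolding weighted_norm_square eq by (rule weighted_inner_diff_left[OF g q weighted_L2_diff[OF g q]])
  also have "\<dots> = weighted_inner \<alpha> \<beta> ?g ?g + weighted_inner \<alpha> \<beta> (poly ?q) (poly ?q)"
    using weighted_inner_diff_left[OF g q g] weighted_inner_diff_left[OF g q q] orth
    by (simp add: weighted_inner_commute[of _ _ _ "\<lambda>x. ?g x - poly ?q x"]
        weighted_inner_commute[of _ _ "poly ?q" ?g])
  also have "\<dots> = (weighted_norm \<alpha> \<beta> ?g)\<^sup>2 + (\<Sum>k\<le>N. (c k - d k)\<^sup>2)"
    by (simp add: weighted_norm_square[symmetric] weighted_norm_jacobi_comb power2_commute)
  also have "\<dots> \<le> (weighted_norm \<alpha> \<beta> ?g + sqrt (\<Sum>k\<le>N. (c k - d k)\<^sup>2))\<^sup>2"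
    by (simp add: power2_sum weighted_norm_nonneg sum_nonneg)
  finally show ?thesis
    by (rule power2_le_imp_le) (simp add: weighted_norm_nonneg sum_nonneg)
qed

end


section \<open>Random sampling\<close>

text \<open>Measuring the deviation in units of the range \<open>S\<close> makes \<open>S\<close>
  cancel in the exponent of Hoeffding's inequality.\<close>

lemma (in prob_space) hoeffding_sum:
  assumes ind: "indep_vars (\<lambda>_. borel) Z {..<n}" and n: "n > 0" and S: "S > (0::real)" and t: "t \<ge> 0"
    and rng: "\<And>i \<omega>. i < n \<Longrightarrow> \<omega> \<in> space M \<Longrightarrow> Z i \<omega> \<in> {0..S}"
    and m: "\<And>i. i < n \<Longrightarrow> expectation (Z i) = m"
  shows "prob {\<omega> \<in> space M. (\<Sum>i<n. Z i \<omega>) \<ge> real n * (m + S * t)} \<le> exp (- 2 * real n * t\<^sup>2)"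
proof -
  interpret H: Hoeffding_ineq M "{..<n}" Z "\<lambda>_. 0" "\<lambda>_. S" "\<Sum>i<n. expectation (Z i)"
    by unfold_locales (use ind rng in \<open>auto intro!: AE_I2\<close>)
  have "prob {\<omega> \<in> space M. (\<Sum>i<n. Z i \<omega>) \<ge> (\<Sum>i<n. expectation (Z i)) + real n * (S * t)} \<le>
      exp (- 2 * (real n * (S * t))\<^sup>2 / (\<Sum>i<n. (S - 0)\<^sup>2))"
    using n S t by (intro H.Hoeffding_ineq_ge) auto
  also have "(\<Sum>i<n. expectation (Z i)) = real n * m" using m by simp
  also have "- 2 * (real n * (S * t))\<^sup>2 / (\<Sum>i<n. (S - 0)\<^sup>2) = - 2 * real n * t\<^sup>2"
    using n S by (simp add: power_mult_distrib field_simps power2_eq_square)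
  finally show ?thesis by (simp add: distrib_left)
qed

text \<open>The joint law has a density with respect to the product of Lebesgue measures, and the
  diagonal is a null set because each of its sections is at most one point.\<close>

lemma (in prob_space) AE_indep_distributed_neq:
  fixes X :: "nat \<Rightarrow> 'a \<Rightarrow> real"
  assumes ind: "indep_vars (\<lambda>_. restrict_space borel S) X I" and S: "S \<in> sets borel"
    and ij: "i \<in> I" "j \<in> I" "i \<noteq> j"
    and dist: "\<And>k. k \<in> I \<Longrightarrow> distributed M (restrict_space lborel S) (X k) g"
  shows "AE \<omega> in M. X i \<omega> \<noteq> X j \<omega>"
proof -
  let ?R = "restrict_space lborel S :: real measure"
  have sf: "sigma_finite_measure ?R"
    using S by (intro sigma_finite_measure_restrict_space lborel.sigma_finite_measure_axioms) simp
  then interpret R: pair_sigma_finite ?R ?R by (simp add: pair_sigma_finite_def)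
  \<comment> \<open>Independence of the pair comes from the subfamilies indexed by the singletons
    \<open>{i}\<close> and \<open>{j}\<close>.\<close>
  have "indep_var (restrict_space borel S) (X i) (restrict_space borel S) (X j)"
  proof -
    have "indep_var (PiM {i} (\<lambda>_. restrict_space borel S)) (\<lambda>\<omega>. restrict (\<lambda>i. X i \<omega>) {i})
        (PiM {j} (\<lambda>_. restrict_space borel S)) (\<lambda>\<omega>. restrict (\<lambda>i. X i \<omega>) {j})"
      using ij by (intro indep_var_restrict[OF ind]) auto
    from indep_var_compose[OF this measurable_component_singleton[of i] measurable_component_singleton[of j]]
    show ?thesis by (simp add: comp_def)
  qed
  \<comment> \<open>The density is taken with respect to \<open>lborel\<close> and independence with
    respect to \<open>borel\<close>; the restricted spaces have the same measurable sets.\<close>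
  then have "indep_var ?R (X i) ?R (X j)"
    unfolding indep_var_eq by (simp add: sets_restrict_space measurable_cong_sets[of M M ?R "restrict_space borel S"])
  from distributed_joint_indep[OF sf sf dist[OF ij(1)] dist[OF ij(2)] this]
  have D: "distr M (?R \<Otimes>\<^sub>M ?R) (\<lambda>\<omega>. (X i \<omega>, X j \<omega>)) = density (?R \<Otimes>\<^sub>M ?R) (\<lambda>(x, y). g x * g y)"
    and Dm: "(\<lambda>(x, y). g x * g y) \<in> borel_measurable (?R \<Otimes>\<^sub>M ?R)"
    and Xm: "(\<lambda>\<omega>. (X i \<omega>, X j \<omega>)) \<in> measurable M (?R \<Otimes>\<^sub>M ?R)"
    by (auto simp: distributed_def)
  have idm: "(\<lambda>x. x) \<in> borel_measurable ?R" by (intro measurable_restrict_space1) simp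
  have m: "{z \<in> space (?R \<Otimes>\<^sub>M ?R). fst z \<noteq> snd z} \<in> sets (?R \<Otimes>\<^sub>M ?R)"
    using measurable_compose[OF measurable_fst idm, of ?R] measurable_compose[OF measurable_snd idm, of ?R]
    by (intro borel_measurable_neq) auto
  have "AE x in ?R. AE y in ?R. fst (x, y) \<noteq> snd (x, y)"
  proof (rule AE_I2)
    fix x :: real
    show "AE y in ?R. fst (x, y) \<noteq> snd (x, y)"
      using AE_lborel_singleton[of x] S by (simp add: AE_restrict_space_iff) (auto elim!: eventually_mono)
  qed
  from R.AE_pair_measure[OF m this] have "AE z in ?R \<Otimes>\<^sub>M ?R. fst z \<noteq> snd z" .
  then have "AE z in density (?R \<Otimes>\<^sub>M ?R) (\<lambda>(x, y). g x * g y). fst z \<noteq> snd z"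
    unfolding AE_density[OF Dm] by (auto elim!: eventually_mono)
  then have "AE z in distr M (?R \<Otimes>\<^sub>M ?R) (\<lambda>\<omega>. (X i \<omega>, X j \<omega>)). fst z \<noteq> snd z"
    unfolding D .
  then show ?thesis
    using Xm m by (simp add: AE_distr_iff)
qed

lemma (in prob_space) AE_inj_on_sample:
  fixes X :: "nat \<Rightarrow> 'a \<Rightarrow> real"
  assumes ind: "indep_vars (\<lambda>_. restrict_space borel S) X {..<n}" and S: "S \<in> sets borel"
    and dist: "\<And>k. k < n \<Longrightarrow> distributed M (restrict_space lborel S) (X k) g"
  shows "AE \<omega> in M. inj_on (\<lambda>i. X i \<omega>) {..<n}"
proof -
  have "AE \<omega> in M. \<forall>i\<in>{..<n}. \<forall>j\<in>{..<n}. i \<noteq> j \<longrightarrow> X i \<omega> \<noteq> X j \<omega>"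
    by (intro AE_finite_allI) (auto intro!: AE_impI AE_indep_distributed_neq[OF ind S] dist)
  then show ?thesis by eventually_elim (auto simp: inj_on_def)
qed

lemma L2_set_le_Max:
  fixes e :: "nat \<Rightarrow> real"
  assumes n: "n > 0"
  shows "sqrt (\<Sum>i<n. (e i)\<^sup>2) \<le> sqrt (real n) * Max ((\<lambda>i. \<bar>e i\<bar>) ` {..<n})"
proof -
  let ?m = "Max ((\<lambda>i. \<bar>e i\<bar>) ` {..<n})"
  have le: "\<bar>e i\<bar> \<le> ?m" if "i < n" for i using that by (intro Max_ge) auto
  have "(\<Sum>i<n. (e i)\<^sup>2) \<le> (\<Sum>i<n. ?m\<^sup>2)"
    using le by (intro sum_mono) (auto simp: abs_le_square_iff[symmetric] intro: order_trans[OF _ abs_ge_self])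
  then have "(\<Sum>i<n. (e i)\<^sup>2) \<le> real n * ?m\<^sup>2" by simp
  moreover have "?m \<ge> 0" using le[OF n] by linarith
  ultimately show ?thesis
    using real_sqrt_le_mono by (fastforce simp: real_sqrt_mult)
qed


section \<open>The estimator\<close>

lemma design_mat_carrier: "design_mat \<alpha> \<beta> n N x \<in> carrier_mat n (N + 1)"
  by (simp add: design_mat_def)

lemma design_mat_mult:
  assumes "j < n" "v \<in> carrier_vec (N + 1)"
  shows "vec_index (design_mat \<alpha> \<beta> n N x *\<^sub>v v) j =
    1 / sqrt (real n) * poly (jacobi_comb \<alpha> \<beta> N (vec_index v)) (x j)"
proof -
  have "vec_index (design_mat \<alpha> \<beta> n N x *\<^sub>v v) j =
      (\<Sum>k<N + 1. 1 / sqrt (real n) * poly (normalized_jacobi \<alpha> \<beta> k) (x j) * vec_index v k)"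
    using assms by (simp add: design_mat_def scalar_prod_def lessThan_atLeast0)
  then show ?thesis
    by (simp add: poly_jacobi_comb lessThan_Suc_atMost sum_distrib_left mult_ac)
qed

text \<open>A kernel vector yields a polynomial of degree at most \<open>N\<close> with
  \<open>n > N\<close> distinct roots. It is therefore zero, and linear independence makes its
  coefficients vanish.\<close>

lemma design_mat_injective:
  assumes ab: "\<alpha> > -1" "\<beta> > -1" and n: "n > N" and inj: "inj_on x {..<n}"
    and v: "v \<in> carrier_vec (N + 1)" "design_mat \<alpha> \<beta> n N x *\<^sub>v v = 0\<^sub>v n"
  shows "v = 0\<^sub>v (N + 1)"
proof -
  let ?q = "jacobi_comb \<alpha> \<beta> N (vec_index v)"
  have root: "poly ?q (x j) = 0" if "j < n" for j
    using design_mat_mult[OF that v(1), of \<alpha> \<beta> x] v(2) that by simp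
  have "?q = 0"
  proof (rule ccontr)
    assume q: "?q \<noteq> 0"
    have "n = card (x ` {..<n})" using inj by (simp add: card_image)
    also have "\<dots> \<le> card {z. poly ?q z = 0}"
      using root by (intro card_mono poly_roots_finite q) auto
    also have "\<dots> \<le> degree ?q" by (rule card_poly_roots_bound[OF q])
    also have "\<dots> \<le> N" by (rule degree_jacobi_comb)
    finally show False using n by simp
  qed
  then show ?thesis
    using v(1) jacobi_comb_eq_0[OF ab] by (intro eq_vecI) auto
qed

text \<open>This is \<open>least_squares_error\<close> for the design matrix, written with
  polynomials. The reference coefficients \<open>c\<close> are arbitrary here and become those of
  the projection later.\<close>

lemma jacobi_estimator_error:
  assumes ab: "\<alpha> > -1" "\<beta> > -1" and n: "n > N" and inj: "inj_on x {..<n}"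
  obtains \<kappa> d where "\<kappa> > 0" "cond_number (gram_mat \<alpha> \<beta> n N x) = ereal \<kappa>"
    "jacobi_estimator \<alpha> \<beta> n N x y = jacobi_comb \<alpha> \<beta> N d"
    "sqrt (\<Sum>k\<le>N. (c k - d k)\<^sup>2) \<le> sqrt (\<kappa> * jacobi_gamma \<alpha> \<beta>) *
      sqrt (1 / real n * (\<Sum>j<n. (y j - poly (jacobi_comb \<alpha> \<beta> N c) (x j))\<^sup>2))"
proof -
  let ?B = "design_mat \<alpha> \<beta> n N x"
  define yv where "yv = Matrix.vec n (\<lambda>j. 1 / sqrt (real n) * y j)"
  define cv where "cv = Matrix.vec (N + 1) c"
  define l where "l = least_squares ?B yv"
  have gam: "jacobi_gamma \<alpha> \<beta> > 0" by (rule jacobi_gamma_pos[OF ab])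
  have yv: "yv \<in> carrier_vec n" and cv: "cv \<in> carrier_vec (N + 1)" by (simp_all add: yv_def cv_def)
  have B: "?B \<in> carrier_mat n (N + 1)" by (rule design_mat_carrier)
  note injB = design_mat_injective[OF ab n inj]
  have l: "l \<in> carrier_vec (N + 1)"
    unfolding l_def by (rule least_squares_eq(1)[OF B yv injB])
  \<comment> \<open>The test vector selects the constant column, with entries
    \<open>1 / sqrt (n * jacobi_gamma \<alpha> \<beta>)\<close>, which makes \<open>g\<close> equal
    to \<open>1 / jacobi_gamma \<alpha> \<beta>\<close>.\<close>
  let ?e = "unit_vec (N + 1) 0 :: real Matrix.vec"
  have e: "?e \<in> carrier_vec (N + 1)" "scalar_prod ?e ?e = 1" by simp_all
  have "scalar_prod (?B *\<^sub>v ?e) (?B *\<^sub>v ?e) = (\<Sum>j<n. 1 / real n * (1 / jacobi_gamma \<alpha> \<beta>))"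
  proof -
    have "poly (jacobi_comb \<alpha> \<beta> N (vec_index ?e)) z = 1 / sqrt (jacobi_gamma \<alpha> \<beta>)" for z
    proof -
      have "poly (jacobi_comb \<alpha> \<beta> N (vec_index ?e)) z =
          (\<Sum>k\<le>N. if k = 0 then poly (normalized_jacobi \<alpha> \<beta> k) z else 0)"
        unfolding poly_jacobi_comb by (intro sum.cong) auto
      then show ?thesis by (simp add: normalized_jacobi_0)
    qed
    then have "vec_index (?B *\<^sub>v ?e) j = 1 / sqrt (real n) * (1 / sqrt (jacobi_gamma \<alpha> \<beta>))" if "j < n" for j
      using design_mat_mult[OF that e(1)] by simp
    then have "scalar_prod (?B *\<^sub>v ?e) (?B *\<^sub>v ?e) =
        (\<Sum>j<n. (1 / sqrt (real n) * (1 / sqrt (jacobi_gamma \<alpha> \<beta>)))\<^sup>2)"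
      unfolding scalar_prod_def power2_eq_square lessThan_atLeast0 by (simp add: design_mat_def)
    then show ?thesis using gam by (simp add: power_mult_distrib power_divide)
  qed
  then have g: "scalar_prod (?B *\<^sub>v ?e) (?B *\<^sub>v ?e) = 1 / jacobi_gamma \<alpha> \<beta>" using n by simp
  obtain \<kappa> where \<kappa>: "\<kappa> > 0" "cond_number (transpose_mat ?B * ?B) = ereal \<kappa>"
    and le: "1 / jacobi_gamma \<alpha> \<beta> * scalar_prod (cv - l) (cv - l) \<le>
      \<kappa> * scalar_prod (?B *\<^sub>v cv - yv) (?B *\<^sub>v cv - yv)"
    using least_squares_error[OF B yv cv injB e g] gam unfolding l_def by auto
  have s1: "scalar_prod (cv - l) (cv - l) = (\<Sum>k\<le>N. (c k - vec_index l k)\<^sup>2)"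
    using l by (simp add: scalar_prod_def cv_def power2_eq_square flip: lessThan_atLeast0 lessThan_Suc_atMost)
  have comb: "jacobi_comb \<alpha> \<beta> N (vec_index cv) = jacobi_comb \<alpha> \<beta> N c"
    unfolding jacobi_comb_def cv_def by (intro sum.cong) auto
  have "vec_index (?B *\<^sub>v cv - yv) j = - (1 / sqrt (real n)) * (y j - poly (jacobi_comb \<alpha> \<beta> N c) (x j))"
    if "j < n" for j
    using design_mat_mult[OF that cv, of \<alpha> \<beta> x] that by (simp add: yv_def comb algebra_simps)
  then have "scalar_prod (?B *\<^sub>v cv - yv) (?B *\<^sub>v cv - yv) =
      (\<Sum>j<n. (- (1 / sqrt (real n)) * (y j - poly (jacobi_comb \<alpha> \<beta> N c) (x j)))\<^sup>2)"
    unfolding scalar_prod_def power2_eq_square lessThan_atLeast0 using yv by simp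
  also have "\<dots> = 1 / real n * (\<Sum>j<n. (y j - poly (jacobi_comb \<alpha> \<beta> N c) (x j))\<^sup>2)"
    by (simp add: power_mult_distrib power_divide sum_distrib_left)
  finally have "(\<Sum>k\<le>N. (c k - vec_index l k)\<^sup>2) \<le> \<kappa> * jacobi_gamma \<alpha> \<beta> *
      (1 / real n * (\<Sum>j<n. (y j - poly (jacobi_comb \<alpha> \<beta> N c) (x j))\<^sup>2))"
    using le gam unfolding s1 by (simp add: field_simps)
  then have "sqrt (\<Sum>k\<le>N. (c k - vec_index l k)\<^sup>2) \<le> sqrt (\<kappa> * jacobi_gamma \<alpha> \<beta>) *
      sqrt (1 / real n * (\<Sum>j<n. (y j - poly (jacobi_comb \<alpha> \<beta> N c) (x j))\<^sup>2))"
    unfolding real_sqrt_mult[symmetric] by (rule real_sqrt_le_mono)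
  moreover have "jacobi_estimator \<alpha> \<beta> n N x y = jacobi_comb \<alpha> \<beta> N (vec_index l)"
    by (simp add: jacobi_estimator_def jacobi_comb_def l_def yv_def)
  ultimately show ?thesis using that \<kappa> by (simp add: gram_mat_def)
qed

text \<open>Minkowski's inequality separates the two contributions, and the root mean square of the
  noise is at most its maximum.\<close>

lemma sqrt_mean_square_add_le:
  fixes g e :: "nat \<Rightarrow> real"
  assumes n: "n > 0"
  shows "sqrt (1 / real n * (\<Sum>j<n. (g j + e j)\<^sup>2)) \<le>
    sqrt (1 / real n * (\<Sum>j<n. (g j)\<^sup>2)) + Max ((\<lambda>i. \<bar>e i\<bar>) ` {..<n})"
proof -
  have "sqrt (\<Sum>j<n. (g j + e j)\<^sup>2) \<le> sqrt (\<Sum>j<n. (g j)\<^sup>2) + sqrt (\<Sum>j<n. (e j)\<^sup>2)"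
    using L2_set_triangle_ineq[of g e "{..<n}"] by (simp add: L2_set_def)
  also note L2_set_le_Max[OF n, of e]
  finally show ?thesis
    using n by (simp add: real_sqrt_mult real_sqrt_divide field_simps)
qed

lemma expectation_jacobi_distributed:
  assumes "distributed M (restrict_space lborel {-1..1}) X
      (\<lambda>x. ennreal (jacobi_weight \<alpha> \<beta> x / jacobi_gamma \<alpha> \<beta>))"
    and gam: "jacobi_gamma \<alpha> \<beta> > 0" and h: "h \<in> borel_measurable (jacobi_measure \<alpha> \<beta>)"
  shows "(LINT \<omega>|M. h (X \<omega>)) = (LINT x|jacobi_measure \<alpha> \<beta>. h x) / jacobi_gamma \<alpha> \<beta>"
proof -
  have hm: "h \<in> borel_measurable (restrict_space lborel {-1..1})"
    using h by (simp add: jacobi_measure_def)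
  have "(LINT x|jacobi_measure \<alpha> \<beta>. h x) = (LINT x|restrict_space lborel {-1..1}. jacobi_weight \<alpha> \<beta> x * h x)"
    unfolding jacobi_measure_def
    using hm weight_measurable_restrict[of \<alpha> \<beta>] by (simp add: integral_density jacobi_weight_nonneg)
  moreover have "(LINT \<omega>|M. h (X \<omega>)) =
      (LINT x|restrict_space lborel {-1..1}. jacobi_weight \<alpha> \<beta> x / jacobi_gamma \<alpha> \<beta> * h x)"
    using gam by (intro distributed_integral[OF assms(1) hm, symmetric]) (simp add: jacobi_weight_nonneg)
  ultimately show ?thesis by simp
qed

section \<open>The supremum norm and the extended real bound\<close>

lemma abs_le_sup_norm:
  assumes "sup_norm f = ereal s" "x \<in> {-1..1}"
  shows "\<bar>f x\<bar> \<le> s"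
proof -
  have "ereal \<bar>f x\<bar> \<le> sup_norm f" unfolding sup_norm_def using assms(2) by (rule SUP_upper)
  then show ?thesis using assms(1) by simp
qed

lemma sup_norm_nonneg: "sup_norm f \<ge> 0"
proof -
  have "0 \<le> ereal \<bar>f 0\<bar>" by simp
  also have "\<dots> \<le> sup_norm f" unfolding sup_norm_def by (rule SUP_upper) simp
  finally show ?thesis .
qed

text \<open>For infinite \<open>s\<close> the positivity of \<open>\<kappa>\<close>,
  \<open>r\<close> and \<open>d\<close> makes the right-hand side infinite. The real inequality is
  therefore required only for finite \<open>s\<close>.\<close>

lemma ereal_error_bound:
  assumes "\<kappa> > 0" "r > 0" "d > 0" "s \<ge> 0"
    and "\<And>s'. s = ereal s' \<Longrightarrow> a \<le> b + sqrt (2 * \<kappa>) * ((r * s' + u + m) / d)"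
  shows "ereal a \<le> ereal b + ereal_sqrt (2 * ereal \<kappa>) * ((ereal r * s + ereal u + ereal m) / ereal d)"
proof -
  have "2 * ereal \<kappa> = ereal (2 * \<kappa>)" by (metis numeral_eq_ereal times_ereal.simps(1))
  then have k: "ereal_sqrt (2 * ereal \<kappa>) = ereal (sqrt (2 * \<kappa>))" by (simp add: ereal_sqrt_def)
  show ?thesis
  proof (cases s)
    case (real s')
    then show ?thesis using assms(3) assms(5)[OF real] unfolding k by simp
  next
    case PInf
    then show ?thesis using assms(1-3) unfolding k by (simp add: divide_ereal_def)
  qed (use assms(4) in simp)
qed

text \<open>Hoeffding's inequality applies to the squares of \<open>g (X i)\<close>, which lie
  between 0 and \<open>s^2\<close>, with relative deviation \<open>r^2\<close>. The fourth root in
  the bound comes from this: \<open>r ^ 4\<close> is \<open>ln (2 / \<delta>) / n\<close>, so the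
  failure probability is at most the square of \<open>\<delta> / 2\<close>.\<close>

lemma (in prob_space) sample_mean_square_concentration:
  fixes X :: "nat \<Rightarrow> 'a \<Rightarrow> real"
  assumes ab: "\<alpha> > -1" "\<beta> > -1" and n: "n > 0" and \<delta>: "0 < \<delta>" "\<delta> < 1"
    and ind: "indep_vars (\<lambda>_. restrict_space borel {-1..1}) X {..<n}"
    and dist: "\<And>i. i < n \<Longrightarrow> distributed M (restrict_space lborel {-1..1}) (X i)
           (\<lambda>x. ennreal (jacobi_weight \<alpha> \<beta> x / jacobi_gamma \<alpha> \<beta>))"
    and g: "g \<in> borel_measurable (jacobi_measure \<alpha> \<beta>)" and s: "sup_norm g = ereal s"
  shows "\<exists>E\<in>events. prob E \<ge> 1 - (\<delta> / 2)\<^sup>2 \<and> (\<forall>\<omega>\<in>E.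
    sqrt (1 / real n * (\<Sum>i<n. (g (X i \<omega>))\<^sup>2)) \<le>
      (1 / real n * ln (2 / \<delta>)) powr (1 / 4) * s + weighted_norm \<alpha> \<beta> g / sqrt (jacobi_gamma \<alpha> \<beta>))"
proof -
  define r where "r = (1 / real n * ln (2 / \<delta>)) powr (1 / 4)"
  define m where "m = (weighted_norm \<alpha> \<beta> g)\<^sup>2 / jacobi_gamma \<alpha> \<beta>"
  define Z where "Z = (\<lambda>i \<omega>. (g (X i \<omega>))\<^sup>2)"
  have gam: "jacobi_gamma \<alpha> \<beta> > 0" by (rule jacobi_gamma_pos[OF ab])
  have gm: "g \<in> borel_measurable (restrict_space borel {-1..1})"
    using g by (simp add: measurable_jacobi_measure_eq)
  have Zind: "indep_vars (\<lambda>_. borel) Z {..<n}"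
    unfolding Z_def using gm by (intro indep_vars_compose2[OF ind]) simp
  have Zm [measurable]: "random_variable borel (Z i)" if "i < n" for i
    using Zind that by (auto simp: indep_vars_def)
  have XI: "X i \<omega> \<in> {-1..1}" if "i < n" "\<omega> \<in> space M" for i \<omega>
  proof -
    have "X i \<in> measurable M (restrict_space borel {-1..1})"
      using ind that(1) by (auto simp: indep_vars_def)
    from measurable_space[OF this that(2)] show ?thesis by (simp add: space_restrict_space)
  qed
  have s0: "s \<ge> 0" using abs_le_sup_norm[OF s, of 0] by simp
  have ZI: "Z i \<omega> \<in> {0..s\<^sup>2}" if "i < n" "\<omega> \<in> space M" for i \<omega>
    using abs_le_sup_norm[OF s XI[OF that]] s0 by (simp add: Z_def abs_le_square_iff[symmetric])
  have EZ: "expectation (Z i) = m" if "i < n" for i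
    unfolding Z_def m_def weighted_norm_square weighted_inner_def power2_eq_square[of "g _", symmetric]
    using expectation_jacobi_distributed[OF dist[OF that] gam, of "\<lambda>x. (g x)\<^sup>2"] g by simp
  have L: "ln (2 / \<delta>) > 0" using \<delta> by simp
  have r4: "r ^ 4 = 1 / real n * ln (2 / \<delta>)" and r0: "r > 0"
    using L n by (simp_all add: r_def powr_power)
  define E where "E = {\<omega> \<in> space M. (\<Sum>i<n. Z i \<omega>) \<le> real n * (m + s\<^sup>2 * r\<^sup>2)}"
  have E: "E \<in> events" unfolding E_def by measurable
  have m0: "m \<ge> 0" using gam by (simp add: m_def)
  have "prob E \<ge> 1 - (\<delta> / 2)\<^sup>2"
  \<comment> \<open>Hoeffding's inequality is applied with a positive range only; for
    \<open>s = 0\<close> all summands vanish and the event is the whole space.\<close>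
  proof (cases "s = 0")
    case True
    have "E = space M" unfolding E_def using ZI True m0 n by (auto intro!: sum_nonpos mult_nonneg_nonneg)
    then show ?thesis by (simp add: prob_space)
  next
    case False
    then have "s\<^sup>2 > 0" by simp
    let ?F = "{\<omega> \<in> space M. (\<Sum>i<n. Z i \<omega>) \<ge> real n * (m + s\<^sup>2 * r\<^sup>2)}"
    have "prob ?F \<le> exp (- 2 * real n * (r\<^sup>2)\<^sup>2)"
      using Zind n \<open>s\<^sup>2 > 0\<close> ZI EZ by (intro hoeffding_sum) auto
    also have "- 2 * real n * (r\<^sup>2)\<^sup>2 = - 2 * ln (2 / \<delta>)"
      using n r4 by (simp flip: power_mult)
    also have "exp (- 2 * ln (2 / \<delta>)) = (\<delta> / 2)\<^sup>2"
    proof -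
      have "exp (- 2 * ln (2 / \<delta>)) = (exp (- ln (2 / \<delta>)))\<^sup>2"
        by (simp add: exp_double[symmetric] flip: exp_of_nat_mult)
      also have "exp (- ln (2 / \<delta>)) = \<delta> / 2" using \<delta> by (simp add: exp_minus)
      finally show ?thesis .
    qed
    finally have F: "prob ?F \<le> (\<delta> / 2)\<^sup>2" .
    have Fm: "?F \<in> events" by measurable
    have "space M - E \<subseteq> ?F" by (auto simp: E_def)
    then have "prob (space M - E) \<le> prob ?F" using Fm by (intro finite_measure_mono)
    then show ?thesis using F prob_compl[OF E] by simp
  qed
  moreover have "sqrt (1 / real n * (\<Sum>i<n. (g (X i \<omega>))\<^sup>2)) \<le> r * s + weighted_norm \<alpha> \<beta> g / sqrt (jacobi_gamma \<alpha> \<beta>)"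
    if "\<omega> \<in> E" for \<omega>
  proof -
    let ?w = "weighted_norm \<alpha> \<beta> g / sqrt (jacobi_gamma \<alpha> \<beta>)"
    have w: "?w \<ge> 0" "?w\<^sup>2 = m" using gam by (simp_all add: weighted_norm_nonneg m_def power_divide)
    have "1 / real n * (\<Sum>i<n. (g (X i \<omega>))\<^sup>2) \<le> m + s\<^sup>2 * r\<^sup>2"
      using that n by (simp add: E_def Z_def field_simps)
    also have "\<dots> \<le> (r * s + ?w)\<^sup>2"
    proof -
      have "0 \<le> 2 * (r * s) * ?w" using w(1) s0 r0 by (intro mult_nonneg_nonneg) auto
      then show ?thesis unfolding power2_sum w(2) by (simp add: power_mult_distrib)
    qed
    finally show ?thesis using w s0 r0 by (intro real_le_lsqrt) auto
  qed
  ultimately show ?thesis using E unfolding r_def by blast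
qed

section \<open>The error bound on a common event\<close>

theorem theorem4:
  fixes \<alpha> \<beta> \<mu> \<sigma> \<delta> r :: real and n N :: nat
    and f :: "real \<Rightarrow> real" and p :: "real poly"
    and M :: "'a measure" and D :: ereal
    and X Y \<epsilon> :: "nat \<Rightarrow> 'a \<Rightarrow> real"
  assumes "\<alpha> \<ge> - 1 / 2" and "\<beta> \<ge> - 1 / 2" and "\<mu> = max \<alpha> \<beta>"
    and "N \<ge> 2" and "n > N"
    and "0.63 * real n > jacobi_m_sq \<alpha> \<beta> * real (N + 1) powr (2 * \<mu> + 2) * ln (real (N + 1))"
    and "f \<in> weighted_L2 \<alpha> \<beta>"
    and "prob_space M"
    and "prob_space.indep_vars M (\<lambda>_. restrict_space borel {-1..1}) X {..<n}"
    and "\<And>i. i < n \<Longrightarrow> distributed M (restrict_space lborel {-1..1}) (X i)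
           (\<lambda>x. ennreal (jacobi_weight \<alpha> \<beta> x / jacobi_gamma \<alpha> \<beta>))"
    and "prob_space.indep_vars M (\<lambda>_. borel) \<epsilon> {..<n}"
    and "\<And>i j. i < n \<Longrightarrow> j < n \<Longrightarrow> distr M borel (\<epsilon> i) = distr M borel (\<epsilon> j)"
    and "\<And>i. i < n \<Longrightarrow> integrable M (\<epsilon> i)"
    and "\<And>i. i < n \<Longrightarrow> integrable M (\<lambda>\<omega>. (\<epsilon> i \<omega>)\<^sup>2)"
    and "\<And>i. i < n \<Longrightarrow> prob_space.expectation M (\<epsilon> i) = 0"
    and "\<And>i. i < n \<Longrightarrow> prob_space.variance M (\<epsilon> i) = \<sigma>\<^sup>2"
    and "\<And>i \<omega>. i < n \<Longrightarrow> \<omega> \<in> space M \<Longrightarrow> Y i \<omega> = f (X i \<omega>) + \<epsilon> i \<omega>"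
    and "p = jacobi_proj \<alpha> \<beta> N f"
    and "0 < \<delta>" and "\<delta> < 1"
    and "r = (1 / real n * ln (2 / \<delta>)) powr (1 / 4)"
    and "D = ereal (1 / sqrt (jacobi_gamma \<alpha> \<beta>))
           - ereal r * (sup_norm (poly p) / ereal (weighted_norm \<alpha> \<beta> (poly p)))"
    and "D > 0"
  shows "\<exists>E\<in>sets M. measure M E \<ge> (1 - \<delta>)\<^sup>2 \<and> (\<forall>\<omega>\<in>E.
     ereal (weighted_norm \<alpha> \<beta>
       (\<lambda>x. f x - poly (jacobi_estimator \<alpha> \<beta> n N (\<lambda>i. X i \<omega>) (\<lambda>i. Y i \<omega>)) x))
     \<le> ereal (weighted_norm \<alpha> \<beta> (\<lambda>x. f x - poly p x))
       + ereal_sqrt (2 * cond_number (gram_mat \<alpha> \<beta> n N (\<lambda>i. X i \<omega>)))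
         * ((ereal r * sup_norm (\<lambda>x. f x - poly p x)
             + ereal (weighted_norm \<alpha> \<beta> (\<lambda>x. f x - poly p x) / sqrt (jacobi_gamma \<alpha> \<beta>))
             + ereal (Max ((\<lambda>i. \<bar>\<epsilon> i \<omega>\<bar>) ` {..<n})))
            / D))"
proof -
  note f = assms(7) and ind = assms(9) and dist = assms(10) and Y = assms(17) and \<delta> = assms(19,20)
    and r_eq = assms(21)
  interpret prob_space M by (rule assms(8))
  have ab: "\<alpha> > -1" "\<beta> > -1" using assms(1,2) by simp_all
  have n: "n > 0" using assms(5) by simp
  have gam: "jacobi_gamma \<alpha> \<beta> > 0" by (rule jacobi_gamma_pos[OF ab])
  have L: "ln (2 / \<delta>) > 0" using \<delta> by simp
  have r: "r > 0" unfolding r_eq using L n by simp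
  obtain c where c: "p = jacobi_comb \<alpha> \<beta> N c"
    and orth: "\<And>d. weighted_inner \<alpha> \<beta> (\<lambda>x. f x - poly (jacobi_comb \<alpha> \<beta> N c) x) (poly (jacobi_comb \<alpha> \<beta> N d)) = 0"
    using jacobi_proj_exists[OF ab f] assms(18) by metis
  let ?g = "\<lambda>x. f x - poly p x"
  have g: "?g \<in> borel_measurable (jacobi_measure \<alpha> \<beta>)"
    using weighted_L2_diff[OF f poly_weighted_L2[OF ab]] by (simp add: weighted_L2_def)
  \<comment> \<open>The subtracted quotient is nonnegative even if the norm of \<open>p\<close> is
    0, since the extended inverse of 0 is infinite. Hence \<open>D\<close> is at most
    \<open>1 / sqrt (jacobi_gamma \<alpha> \<beta>)\<close>, and together with \<open>D > 0\<close>
    this makes it a positive real.\<close>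
  obtain d where d: "D = ereal d" "0 < d" "d \<le> 1 / sqrt (jacobi_gamma \<alpha> \<beta>)"
  proof -
    have "0 \<le> sup_norm (poly p) / ereal (weighted_norm \<alpha> \<beta> (poly p))"
      unfolding divide_ereal_def
      by (intro ereal_0_le_mult ereal_inverse_nonneg_iff[THEN iffD2])
        (simp_all add: sup_norm_nonneg weighted_norm_nonneg)
    then have "0 \<le> ereal r * (sup_norm (poly p) / ereal (weighted_norm \<alpha> \<beta> (poly p)))"
      using r by simp
    then have "D \<le> ereal (1 / sqrt (jacobi_gamma \<alpha> \<beta>))"
      unfolding assms(22) by (rule ereal_diff_le_self)
    then show ?thesis using that assms(23) by (cases D) auto
  qed
  \<comment> \<open>Distinct sample points make the Gram matrix invertible; the almost sure
    statement is turned into an event of probability one.\<close>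
  have "AE \<omega> in M. inj_on (\<lambda>i. X i \<omega>) {..<n}"
    by (rule AE_inj_on_sample[OF ind _ dist]) auto
  then obtain E0 where E0: "E0 \<in> events" "prob E0 = 1" "E0 \<subseteq> {\<omega> \<in> space M. inj_on (\<lambda>i. X i \<omega>) {..<n}}"
    by (rule AE_E_prob) blast
  \<comment> \<open>If the supremum norm is infinite, the condition on \<open>s\<close> is vacuous
    and \<open>G\<close> is the whole space.\<close>
  have "\<exists>G\<in>events. prob G \<ge> 1 - (\<delta> / 2)\<^sup>2 \<and> (\<forall>\<omega>\<in>G. \<forall>s. sup_norm ?g = ereal s \<longrightarrow>
      sqrt (1 / real n * (\<Sum>i<n. (?g (X i \<omega>))\<^sup>2)) \<le>
        r * s + weighted_norm \<alpha> \<beta> ?g / sqrt (jacobi_gamma \<alpha> \<beta>))"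
  proof (cases "\<exists>s. sup_norm ?g = ereal s")
    case True
    then obtain s where s: "sup_norm ?g = ereal s" by blast
    show ?thesis
      using sample_mean_square_concentration[OF ab n \<delta> ind dist g s] unfolding r_eq s by simp
  next
    case False
    then show ?thesis by (intro bexI[of _ "space M"]) (auto simp: prob_space)
  qed
  then obtain G where G: "G \<in> events" "prob G \<ge> 1 - (\<delta> / 2)\<^sup>2"
    and Gb: "\<And>\<omega> s. \<omega> \<in> G \<Longrightarrow> sup_norm ?g = ereal s \<Longrightarrow>
      sqrt (1 / real n * (\<Sum>i<n. (?g (X i \<omega>))\<^sup>2)) \<le>
        r * s + weighted_norm \<alpha> \<beta> ?g / sqrt (jacobi_gamma \<alpha> \<beta>)"
    by blast
  have "prob (E0 \<inter> G) = prob G"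
    using E0(1,2) G(1) AE_prob_1[OF E0(2)] by (intro measure_eq_AE) auto
  moreover have "(1 - \<delta>)\<^sup>2 \<le> 1 - (\<delta> / 2)\<^sup>2"
  proof -
    have "\<delta> * \<delta> \<le> \<delta>" using \<delta> by (simp add: mult_left_le)
    then show ?thesis using \<delta> by (simp add: power2_eq_square algebra_simps)
  qed
  ultimately have prob: "prob (E0 \<inter> G) \<ge> (1 - \<delta>)\<^sup>2" using G(2) by linarith
  have bound: "ereal (weighted_norm \<alpha> \<beta>
       (\<lambda>x. f x - poly (jacobi_estimator \<alpha> \<beta> n N (\<lambda>i. X i \<omega>) (\<lambda>i. Y i \<omega>)) x))
     \<le> ereal (weighted_norm \<alpha> \<beta> ?g)
       + ereal_sqrt (2 * cond_number (gram_mat \<alpha> \<beta> n N (\<lambda>i. X i \<omega>)))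
         * ((ereal r * sup_norm ?g + ereal (weighted_norm \<alpha> \<beta> ?g / sqrt (jacobi_gamma \<alpha> \<beta>))
             + ereal (Max ((\<lambda>i. \<bar>\<epsilon> i \<omega>\<bar>) ` {..<n}))) / D)"
    if \<omega>: "\<omega> \<in> E0 \<inter> G" for \<omega>
  proof -
    let ?m = "Max ((\<lambda>i. \<bar>\<epsilon> i \<omega>\<bar>) ` {..<n})"
    let ?u = "weighted_norm \<alpha> \<beta> ?g / sqrt (jacobi_gamma \<alpha> \<beta>)"
    have inj: "inj_on (\<lambda>i. X i \<omega>) {..<n}" and sp: "\<omega> \<in> space M" using \<omega> E0(3) by auto
    obtain \<kappa> e where \<kappa>: "\<kappa> > 0" "cond_number (gram_mat \<alpha> \<beta> n N (\<lambda>i. X i \<omega>)) = ereal \<kappa>"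
      and est: "jacobi_estimator \<alpha> \<beta> n N (\<lambda>i. X i \<omega>) (\<lambda>i. Y i \<omega>) = jacobi_comb \<alpha> \<beta> N e"
      and err: "sqrt (\<Sum>k\<le>N. (c k - e k)\<^sup>2) \<le> sqrt (\<kappa> * jacobi_gamma \<alpha> \<beta>) *
        sqrt (1 / real n * (\<Sum>j<n. (Y j \<omega> - poly (jacobi_comb \<alpha> \<beta> N c) (X j \<omega>))\<^sup>2))"
      by (rule jacobi_estimator_error[OF ab assms(5) inj])
    have Yg: "Y j \<omega> - poly (jacobi_comb \<alpha> \<beta> N c) (X j \<omega>) = ?g (X j \<omega>) + \<epsilon> j \<omega>" if "j < n" for j
      using Y[OF that sp] by (simp add: c)
    have "weighted_norm \<alpha> \<beta> (\<lambda>x. f x - poly (jacobi_comb \<alpha> \<beta> N e) x) \<le>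
        weighted_norm \<alpha> \<beta> ?g + sqrt (2 * \<kappa>) * ((r * s + ?u + ?m) / d)" if s: "sup_norm ?g = ereal s" for s
    proof -
      have m0: "?m \<ge> 0" using n by (subst Max_ge_iff) auto
      have s0: "s \<ge> 0" using sup_norm_nonneg[of ?g] s by simp
      have u0: "?u \<ge> 0" using gam by (simp add: weighted_norm_nonneg)
      have "sqrt (1 / real n * (\<Sum>j<n. (Y j \<omega> - poly (jacobi_comb \<alpha> \<beta> N c) (X j \<omega>))\<^sup>2)) =
          sqrt (1 / real n * (\<Sum>j<n. (?g (X j \<omega>) + \<epsilon> j \<omega>)\<^sup>2))"
        using Yg by simp
      also have "\<dots> \<le> sqrt (1 / real n * (\<Sum>j<n. (?g (X j \<omega>))\<^sup>2)) + ?m"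
        by (rule sqrt_mean_square_add_le[OF n])
      also have "\<dots> \<le> r * s + ?u + ?m" using Gb[OF _ s] \<omega> by simp
      finally have "sqrt (\<Sum>k\<le>N. (c k - e k)\<^sup>2) \<le> sqrt (\<kappa> * jacobi_gamma \<alpha> \<beta>) * (r * s + ?u + ?m)"
        using err mult_left_mono[of _ _ "sqrt (\<kappa> * jacobi_gamma \<alpha> \<beta>)"] \<kappa>(1) gam
        by (meson order_trans real_sqrt_ge_zero mult_nonneg_nonneg less_imp_le)
      also have "\<dots> \<le> sqrt (2 * \<kappa>) / d * (r * s + ?u + ?m)"
      proof (rule mult_right_mono)
        \<comment> \<open>Here \<open>d \<le> 1 / sqrt (jacobi_gamma \<alpha> \<beta>)\<close>
          replaces the mass of the weight by the denominator of the claimed bound.\<close>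
        have "sqrt (jacobi_gamma \<alpha> \<beta>) \<le> 1 / d" using d(2,3) gam by (simp add: field_simps)
        moreover have "sqrt \<kappa> \<le> sqrt (2 * \<kappa>)" using \<kappa>(1) by simp
        ultimately have "sqrt \<kappa> * sqrt (jacobi_gamma \<alpha> \<beta>) \<le> sqrt (2 * \<kappa>) * (1 / d)"
          using \<kappa>(1) gam by (intro mult_mono) auto
        then show "sqrt (\<kappa> * jacobi_gamma \<alpha> \<beta>) \<le> sqrt (2 * \<kappa>) / d" by (simp add: real_sqrt_mult)
        show "0 \<le> r * s + ?u + ?m" using r s0 u0 m0 by simp
      qed
      finally show ?thesis
        using weighted_norm_diff_comb_le[OF ab f orth, of e] by (simp add: c)
    qed
    then show ?thesis
      unfolding est \<kappa>(2) d(1) by (intro ereal_error_bound \<kappa>(1) r d(2) sup_norm_nonneg)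
  qed
  show ?thesis using E0(1) G(1) prob bound by (intro bexI[of _ "E0 \<inter> G"]) auto
qed

end
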